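(* Let $d\ge1$. For $\mu,\nu\in\mathcal{M}_+(\mathbb{R}^d)$ let $$D_{2,w}(\mu,\nu):=\sup\left\{\left|\int_{\mathbb{R}^d}\phi\,d\mu-\int_{\mathbb{R}^d}\phi\,d\nu\right| : \phi\in C_{0,w}^2(\mathbb{R}^d),\ \|\phi\|_{C^2_{0,w}}\le1\right\}.$$ Then: (1) $D_{2,w}$ is a distance over $\mathcal{M}_+(\mathbb{R}^d)$; (2) $D_{2,w}$ is a complete metric on $\mathcal{M}_+(\mathbb{R}^d)$ that metrizes narrow convergence. In particular, $(\mathcal{P}(\mathbb{R}^d),D_{2,w})$ is a complete and separable metric space; (3) there exists a countable subset $\mathcal{S}_{2,w}\subset C_c^2(\mathbb{R}^d)$, dense in the unit ball of $(C^2_{0,w}(\mathbb{R}^d),\|\cdot\|_{C^2_{0,w}})$, such that, for all $\mu,\nu\in\mathcal{M}_+(\mathbb{R}^d)$, $$D_{2,w}(\mu,\nu)=\sup\left\{\left|\int_{\mathbb{R}^d}\phi\,d\mu-\int_{\mathbb{R}^d}\phi\,d\nu\right| : \phi\in\mathcal{S}_{2,w}\right\}.$$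
   Context: $\mathcal{M}_+(\mathbb{R}^d)$ is the set of finite non-negative Borel measures on $\mathbb{R}^d$, $\mathcal{P}(\mathbb{R}^d)$ the subset of probability measures; narrow convergence is convergence of integrals against all bounded continuous functions. $C^2_{0,w}(\mathbb{R}^d)$ is the closure of $C_c^2(\mathbb{R}^d)$ (compactly supported $C^2$ functions) with respect to the norm $\|\phi\|_{C^2_{0,w}}=\|\phi\|_\infty+\|(1+|\cdot|)\nabla\phi\|_\infty+\|(1+|\cdot|^2)\nabla^{2}\phi\|_\infty$, where pointwise norms of the gradient and Hessian are Euclidean norms of the entries. The unit ball is closed, and a dense subset of it is a subset of it whose closure is the whole ball. *)

theory Defs
  imports "HOL-Analysis.Analysis" "HOL-Probability.Probability"
begin

definition grad :: "(real^'d \<Rightarrow> real) \<Rightarrow> real^'d \<Rightarrow> real^'d" where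
  "grad f x = (\<chi> i. frechet_derivative f (at x) (axis i 1))"

definition hess :: "(real^'d \<Rightarrow> real) \<Rightarrow> real^'d \<Rightarrow> real^'d^'d" where
  "hess f x = jacobian (grad f) (at x)"

definition C2 :: "(real^'d \<Rightarrow> real) set" where
  "C2 = {f. f differentiable_on UNIV \<and> continuous_on UNIV (grad f) \<and>
            grad f differentiable_on UNIV \<and> continuous_on UNIV (hess f)}"

definition C2c :: "(real^'d \<Rightarrow> real) set" where
  "C2c = {f \<in> C2. compact (closure {x. f x \<noteq> 0})}"

text \<open>
  \<open>C2w\<close> consists of the \<open>C\<^sup>2\<close> functions of finite weighted norm; it is the
  ambient space in which closures are taken, and the suprema in \<open>norm_w\<close> are
  meaningful only there. The norm on \<^typ>\<open>real^'d^'d\<close> is the Euclidean norm of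
  the entries.
\<close>

definition C2w :: "(real^'d \<Rightarrow> real) set" where
  "C2w = {f \<in> C2. bounded (range f) \<and>
            bounded (range (\<lambda>x. (1 + norm x) * norm (grad f x))) \<and>
            bounded (range (\<lambda>x. (1 + (norm x)\<^sup>2) * norm (hess f x)))}"

definition norm_w :: "(real^'d \<Rightarrow> real) \<Rightarrow> real" where
  "norm_w f = (SUP x. \<bar>f x\<bar>) + (SUP x. (1 + norm x) * norm (grad f x))
                + (SUP x. (1 + (norm x)\<^sup>2) * norm (hess f x))"

definition closure_w :: "(real^'d \<Rightarrow> real) set \<Rightarrow> (real^'d \<Rightarrow> real) set" where
  "closure_w A = {f \<in> C2w. \<forall>e>0. \<exists>g\<in>A. norm_w (\<lambda>x. f x - g x) < e}"

definition C20w :: "(real^'d \<Rightarrow> real) set" where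
  "C20w = closure_w C2c"

definition ball_w :: "(real^'d \<Rightarrow> real) set" where
  "ball_w = {f \<in> C20w. norm_w f \<le> 1}"

definition Mplus :: "(real^'d) measure set" where
  "Mplus = {\<mu>. sets \<mu> = sets borel \<and> finite_measure \<mu>}"

definition Prob :: "(real^'d) measure set" where
  "Prob = {\<mu> \<in> Mplus. prob_space \<mu>}"

text \<open>
  The value 0 outside \<^const>\<open>Mplus\<close> is a totalisation only: \<^locale>\<open>Metric_space\<close> asks for
  nonnegativity and symmetry on the whole type. Inside \<^const>\<open>Mplus\<close> the supremum is that of a
  nonempty set bounded above, see \<open>ball_w_nonempty\<close> and \<open>bdd_above_D2w\<close> below.
\<close>

definition D2w :: "(real^'d) measure \<Rightarrow> (real^'d) measure \<Rightarrow> real" where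
  "D2w \<mu> \<nu> = (if \<mu> \<in> Mplus \<and> \<nu> \<in> Mplus
      then (SUP \<phi>\<in>ball_w. \<bar>(\<integral>x. \<phi> x \<partial>\<mu>) - (\<integral>x. \<phi> x \<partial>\<nu>)\<bar>) else 0)"

definition narrow_conv ::
    "('i \<Rightarrow> (real^'d) measure) \<Rightarrow> (real^'d) measure \<Rightarrow> 'i filter \<Rightarrow> bool" where
  "narrow_conv \<mu>s \<mu> F \<longleftrightarrow>
     (\<forall>h :: real^'d \<Rightarrow> real. continuous_on UNIV h \<and> bounded (range h) \<longrightarrow>
        ((\<lambda>i. \<integral>x. h x \<partial>(\<mu>s i)) \<longlongrightarrow> (\<integral>x. h x \<partial>\<mu>)) F)"

lemma ball_w_nonempty: "(ball_w :: (real^'d \<Rightarrow> real) set) \<noteq> {}"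
proof -
  let ?z = "(\<lambda>x. 0) :: real^'d \<Rightarrow> real"
  have g: "grad ?z = (\<lambda>x. 0)"
    by (auto simp: grad_def vec_eq_iff)
  have "frechet_derivative (\<lambda>y :: real^'d. 0 :: real^'d) (at x) = (\<lambda>y. 0)" for x :: "real^'d"
    by (rule frechet_derivative_at[symmetric]) (rule has_derivative_const)
  hence h: "hess ?z = (\<lambda>x. 0)"
    by (auto simp: hess_def g jacobian_def matrix_def vec_eq_iff)
  have "?z \<in> C2c" "?z \<in> C2w" "norm_w ?z = 0"
    by (auto simp: C2c_def C2w_def C2_def norm_w_def g h)
  hence "?z \<in> ball_w"
    unfolding ball_w_def C20w_def closure_w_def by (auto intro!: bexI[of _ ?z])
  thus ?thesis by blast
qed

lemma bounded_nonneg_SUP_ge: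
  fixes u :: "'a \<Rightarrow> real"
  assumes "bounded (range u)" "\<And>x. u x \<ge> 0"
  shows "u x \<le> (SUP x. u x)" "0 \<le> (SUP x. u x)"
proof -
  show "u x \<le> (SUP x. u x)"
    using assms(1) by (intro cSUP_upper bounded_imp_bdd_above) auto
  thus "0 \<le> (SUP x. u x)" using assms(2)[of x] by linarith
qed

lemma ball_w_abs_le:
  assumes "\<phi> \<in> ball_w"
  shows "\<bar>\<phi> x\<bar> \<le> 1"
proof -
  have b: "\<phi> \<in> C2w" "norm_w \<phi> \<le> 1"
    using assms by (auto simp: ball_w_def C20w_def closure_w_def)
  have "bounded (range (\<lambda>x. \<bar>\<phi> x\<bar>))"
    using b(1) by (auto simp: C2w_def bounded_iff)
  from bounded_nonneg_SUP_ge(1)[OF this, of x] show ?thesis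
    using b bounded_nonneg_SUP_ge(2)[of "\<lambda>x. (1 + norm x) * norm (grad \<phi> x)"]
      bounded_nonneg_SUP_ge(2)[of "\<lambda>x. (1 + (norm x)\<^sup>2) * norm (hess \<phi> x)"]
    by (auto simp: C2w_def norm_w_def)
qed

lemma ball_w_integral_le:
  assumes "\<phi> \<in> ball_w" "\<mu> \<in> Mplus"
  shows "integrable \<mu> \<phi>" "\<bar>\<integral>x. \<phi> x \<partial>\<mu>\<bar> \<le> measure \<mu> (space \<mu>)"
proof -
  interpret finite_measure \<mu> using assms by (simp add: Mplus_def)
  have "continuous_on UNIV \<phi>"
    using assms by (auto simp: ball_w_def C20w_def closure_w_def C2w_def C2_def
        intro: differentiable_imp_continuous_on)
  hence "\<phi> \<in> borel_measurable \<mu>"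
    using assms(2) by (simp add: Mplus_def borel_measurable_continuous_onI cong: measurable_cong_sets)
  thus i: "integrable \<mu> \<phi>"
    using ball_w_abs_le[OF assms(1)] by (intro integrable_const_bound[of _ 1]) auto
  have "\<bar>\<integral>x. \<phi> x \<partial>\<mu>\<bar> \<le> (\<integral>x. \<bar>\<phi> x\<bar> \<partial>\<mu>)" by (rule integral_abs_bound)
  also have "\<dots> \<le> (\<integral>x. 1 \<partial>\<mu>)"
    using i ball_w_abs_le[OF assms(1)] by (intro integral_mono) auto
  finally show "\<bar>\<integral>x. \<phi> x \<partial>\<mu>\<bar> \<le> measure \<mu> (space \<mu>)" by simp
qed

lemma bdd_above_D2w:
  assumes "\<mu> \<in> Mplus" "\<nu> \<in> Mplus"
  shows "bdd_above ((\<lambda>\<phi>. \<bar>(\<integral>x. \<phi> x \<partial>\<mu>) - (\<integral>x. \<phi> x \<partial>\<nu>)\<bar>) ` ball_w)"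
proof (rule bdd_aboveI2)
  fix \<phi> :: "real^'a \<Rightarrow> real" assume "\<phi> \<in> ball_w"
  from ball_w_integral_le(2)[OF this assms(1)] ball_w_integral_le(2)[OF this assms(2)]
  show "\<bar>(\<integral>x. \<phi> x \<partial>\<mu>) - (\<integral>x. \<phi> x \<partial>\<nu>)\<bar> \<le> measure \<mu> (space \<mu>) + measure \<nu> (space \<nu>)"
    by linarith
qed

end

theory Submission
  imports Defs
begin

text \<open>
  The weights grow at the rate at which dilation shrinks derivatives, so the cutoffs \<open>(1 - |x/R|\<^sup>2)\<^sub>+\<^sup>3\<close> have norm bounded
  uniformly in \<open>R \<ge> 1\<close>; letting \<open>R\<close> tend to infinity, the distance controls the difference of total
  masses although all test functions vanish at infinity. Together with Stone-Weierstrass (polynomials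
  times cutoffs lie in \<open>C\<^sub>c\<^sup>2\<close>) this gives narrow convergence from convergence of the distance, and
  tightness of Cauchy sequences, so completeness follows from Prokhorov's theorem. Conversely the
  functions of the unit ball are bounded by 1 and 1-Lipschitz, hence on a large ball uniformly
  approximated by combinations of one finite partition of unity; finitely many bounded continuous
  functions therefore control the distance, also along nets.
\<close>

section \<open>Calculus in \<open>C\<^sup>2\<close> and the weighted norm\<close>

text \<open>Metrization is claimed along every filter, and a narrowly convergent net need not be
  tight. So the large ball is chosen for the limit alone, and one continuous function, dominated by
  the indicator of the exterior, carries the smallness of the tail over to the net. Prokhorov's
  theorem is taken from Helly selection on the line. Take a continuous surjection \<open>f\<close>
  from the line onto the space with a Borel section \<open>s\<close>. The integral of
  \<open>h\<close> against a measure is the integral of \<open>h\<close> after \<open>f\<close>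
  against its image under \<open>s\<close>, and \<open>h\<close> after \<open>f\<close> is again
  bounded and continuous. Continuity is thus asked of \<open>f\<close> only; \<open>s\<close> has to
  be Borel and of at most linear growth, the latter so that tight families stay tight on the line.
  Both separability claims use one device: an object is coded by a radius and finitely many
  approximate values, and there are only countably many codes.\<close>

lemma C2I:
  fixes f :: "real^'d \<Rightarrow> real"
  assumes f: "\<And>x. (f has_derivative (\<lambda>h. G x \<bullet> h)) (at x)"
    and G: "\<And>x. (G has_derivative (\<lambda>h. H x *v h)) (at x)"
    and H: "continuous_on UNIV H"
  shows "f \<in> C2" "grad f = G" "hess f = H"
proof -
  \<comment> \<open>\<open>grad\<close> and \<open>hess\<close> rest on
    \<open>frechet_derivative\<close>, which is a choice; uniqueness of derivatives identifies it
    with the candidates.\<close>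
  have g: "grad f = G"
  proof
    fix x
    show "grad f x = G x"
      by (simp add: grad_def frechet_derivative_at[OF f, symmetric] inner_axis vec_eq_iff)
  qed
  have h: "hess f = H"
  proof
    fix x
    show "hess f x = H x"
      by (simp add: hess_def g jacobian_def frechet_derivative_at[OF G, symmetric])
  qed
  have "G differentiable_on UNIV" "f differentiable_on UNIV"
    using f G by (auto simp: differentiable_on_def differentiable_def)
  thus "f \<in> C2"
    using H by (simp add: C2_def g h differentiable_imp_continuous_on)
  show "grad f = G" "hess f = H" by fact+
qed

lemma C2D:
  fixes f :: "real^'d \<Rightarrow> real"
  assumes "f \<in> C2"
  shows "(f has_derivative (\<lambda>h. grad f x \<bullet> h)) (at x)"
    and "(grad f has_derivative (\<lambda>h. hess f x *v h)) (at x)"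
    and "continuous_on A f" "continuous_on A (grad f)" "continuous_on A (hess f)"
proof -
  have f: "f differentiable (at x)" and G: "grad f differentiable (at x)"
    using assms by (auto simp: C2_def differentiable_on_def)
  let ?L = "frechet_derivative f (at x)"
  have "?L = (\<lambda>h. grad f x \<bullet> h)"
  proof
    fix h
    have lin: "linear ?L" using f by (rule linear_frechet_derivative)
    have "?L h = ?L (\<Sum>i\<in>UNIV. (h $ i) *s axis i 1)" by (simp add: basis_expansion)
    also have "\<dots> = (\<Sum>i\<in>UNIV. (h $ i) * ?L (axis i 1))"
      by (simp add: linear_sum[OF lin] scalar_mult_eq_scaleR linear_cmul[OF lin])
    also have "\<dots> = grad f x \<bullet> h" by (simp add: grad_def inner_vec_def mult.commute)
    finally show "?L h = grad f x \<bullet> h" .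
  qed
  thus "(f has_derivative (\<lambda>h. grad f x \<bullet> h)) (at x)"
    using f frechet_derivative_works by metis
  show "(grad f has_derivative (\<lambda>h. hess f x *v h)) (at x)"
    using G jacobian_works unfolding hess_def by blast
  have "continuous_on UNIV f" "continuous_on UNIV (grad f)" "continuous_on UNIV (hess f)"
    using assms by (auto simp: C2_def differentiable_imp_continuous_on)
  thus "continuous_on A f" "continuous_on A (grad f)" "continuous_on A (hess f)"
    using continuous_on_subset by blast+
qed

text \<open>The rank-one matrix \<open>u v^T\<close>: products of gradients enter the Hessians of
  products and compositions in this form. Its Euclidean norm of entries factorizes.\<close>

definition outer :: "real^'d \<Rightarrow> real^'d \<Rightarrow> real^'d^'d" where
  "outer u v = (\<chi> i. u $ i *\<^sub>R v)"

lemma outer_mult_vec: "outer u v *v h = (v \<bullet> h) *\<^sub>R u"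
  by (simp add: outer_def matrix_vector_mult_def vec_eq_iff inner_vec_def sum_distrib_left mult_ac)

lemma norm_outer: "norm (outer u v) = norm u * norm v"
proof -
  have "norm (outer u v) = L2_set (\<lambda>i. norm (u $ i) * norm v) UNIV"
    unfolding norm_vec_def[of "outer u v"] by (simp add: outer_def)
  also have "\<dots> = norm u * norm v"
    unfolding norm_vec_def[of u] by (simp only: L2_set_left_distrib[OF norm_ge_zero])
  finally show ?thesis .
qed

lemma continuous_on_outer [continuous_intros]:
  "continuous_on A f \<Longrightarrow> continuous_on A g \<Longrightarrow> continuous_on A (\<lambda>x. outer (f x) (g x))"
  unfolding outer_def by (intro continuous_intros)

lemma scaleR_matrix_vec: "(c *\<^sub>R A) *v x = c *\<^sub>R (A *v (x::real^'n))" for A :: "real^'n^'m"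
  by (simp add: scaleR_matrix_vector_assoc)

lemma C2_const:
  shows "(\<lambda>x. c) \<in> C2" "grad (\<lambda>x. c) = (\<lambda>x. 0)" "hess (\<lambda>x. c) = (\<lambda>x. 0)"
  by (rule C2I[of _ "\<lambda>x. 0" "\<lambda>x. 0"]; auto intro!: derivative_eq_intros)+

lemma C2_inner:
  shows "(\<lambda>x. v \<bullet> x) \<in> C2" "grad (\<lambda>x. v \<bullet> x) = (\<lambda>x. v)" "hess (\<lambda>x. v \<bullet> x) = (\<lambda>x. 0)"
  by (rule C2I[of _ "\<lambda>x. v" "\<lambda>x. 0"]; auto intro!: derivative_eq_intros)+

lemma
  fixes f g :: "real^'d \<Rightarrow> real"
  assumes f: "f \<in> C2" and g: "g \<in> C2"
  shows C2_add: "(\<lambda>x. f x + g x) \<in> C2"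
    and grad_add: "grad (\<lambda>x. f x + g x) = (\<lambda>x. grad f x + grad g x)"
    and hess_add: "hess (\<lambda>x. f x + g x) = (\<lambda>x. hess f x + hess g x)"
proof -
  have 1: "((\<lambda>x. f x + g x) has_derivative (\<lambda>h. (grad f x + grad g x) \<bullet> h)) (at x)" for x
    using C2D(1)[OF f] C2D(1)[OF g] by (auto intro!: derivative_eq_intros simp: inner_add_left)
  have 2: "((\<lambda>x. grad f x + grad g x) has_derivative (\<lambda>h. (hess f x + hess g x) *v h)) (at x)" for x
    using C2D(2)[OF f] C2D(2)[OF g]
    by (auto intro!: derivative_eq_intros simp: matrix_vector_mult_add_rdistrib)
  have 3: "continuous_on UNIV (\<lambda>x. hess f x + hess g x)"
    by (intro continuous_intros C2D f g)
  show "(\<lambda>x. f x + g x) \<in> C2"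
    "grad (\<lambda>x. f x + g x) = (\<lambda>x. grad f x + grad g x)"
    "hess (\<lambda>x. f x + g x) = (\<lambda>x. hess f x + hess g x)"
    using C2I[OF 1 2 3] by auto
qed

lemma
  fixes f g :: "real^'d \<Rightarrow> real"
  assumes f: "f \<in> C2" and g: "g \<in> C2"
  shows C2_mult: "(\<lambda>x. f x * g x) \<in> C2"
    and grad_mult: "grad (\<lambda>x. f x * g x) = (\<lambda>x. f x *\<^sub>R grad g x + g x *\<^sub>R grad f x)"
    and hess_mult: "hess (\<lambda>x. f x * g x) = (\<lambda>x. f x *\<^sub>R hess g x + outer (grad g x) (grad f x)
          + g x *\<^sub>R hess f x + outer (grad f x) (grad g x))"
proof -
  have 1: "((\<lambda>x. f x * g x) has_derivative (\<lambda>h. (f x *\<^sub>R grad g x + g x *\<^sub>R grad f x) \<bullet> h)) (at x)" for x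
    using C2D(1)[OF f, of x] C2D(1)[OF g, of x]
    by (auto intro!: derivative_eq_intros simp: inner_add_left)
  have 2: "((\<lambda>x. f x *\<^sub>R grad g x + g x *\<^sub>R grad f x) has_derivative
      (\<lambda>h. (f x *\<^sub>R hess g x + outer (grad g x) (grad f x)
          + g x *\<^sub>R hess f x + outer (grad f x) (grad g x)) *v h)) (at x)" for x
    using C2D(1,2)[OF f, of x] C2D(1,2)[OF g, of x]
    by (auto intro!: derivative_eq_intros
        simp: matrix_vector_mult_add_rdistrib scaleR_matrix_vec outer_mult_vec)
  have 3: "continuous_on UNIV (\<lambda>x. f x *\<^sub>R hess g x + outer (grad g x) (grad f x)
          + g x *\<^sub>R hess f x + outer (grad f x) (grad g x))"
    by (intro continuous_intros C2D f g)
  show "(\<lambda>x. f x * g x) \<in> C2"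
    "grad (\<lambda>x. f x * g x) = (\<lambda>x. f x *\<^sub>R grad g x + g x *\<^sub>R grad f x)"
    "hess (\<lambda>x. f x * g x) = (\<lambda>x. f x *\<^sub>R hess g x + outer (grad g x) (grad f x)
          + g x *\<^sub>R hess f x + outer (grad f x) (grad g x))"
    using C2I[OF 1 2 3] by auto
qed

lemma
  fixes f :: "real^'d \<Rightarrow> real"
  assumes f: "f \<in> C2"
  shows C2_cmult: "(\<lambda>x. c * f x) \<in> C2"
    and grad_cmult: "grad (\<lambda>x. c * f x) = (\<lambda>x. c *\<^sub>R grad f x)"
    and hess_cmult: "hess (\<lambda>x. c * f x) = (\<lambda>x. c *\<^sub>R hess f x)"
proof -
  have "outer 0 v = 0" "outer v 0 = 0" for v :: "real^'d" by (simp_all add: outer_def vec_eq_iff)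
  thus "(\<lambda>x. c * f x) \<in> C2" "grad (\<lambda>x. c * f x) = (\<lambda>x. c *\<^sub>R grad f x)"
    "hess (\<lambda>x. c * f x) = (\<lambda>x. c *\<^sub>R hess f x)"
    using C2_mult[OF C2_const(1) f, of c] grad_mult[OF C2_const(1) f, of c]
      hess_mult[OF C2_const(1) f, of c] by (simp_all add: C2_const)
qed

lemma
  fixes f g :: "real^'d \<Rightarrow> real"
  assumes f: "f \<in> C2" and g: "g \<in> C2"
  shows C2_diff: "(\<lambda>x. f x - g x) \<in> C2"
    and grad_diff: "grad (\<lambda>x. f x - g x) = (\<lambda>x. grad f x - grad g x)"
    and hess_diff: "hess (\<lambda>x. f x - g x) = (\<lambda>x. hess f x - hess g x)"
  using C2_add[OF f C2_cmult[OF g, of "-1"]] grad_add[OF f C2_cmult[OF g, of "-1"]]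
    hess_add[OF f C2_cmult[OF g, of "-1"]]
  by (simp_all add: grad_cmult[OF g, of "-1", simplified] hess_cmult[OF g, of "-1", simplified])

lemma
  fixes f :: "real^'d \<Rightarrow> real"
  assumes f: "f \<in> C2"
    and u: "\<And>t. (u has_real_derivative u' t) (at t)"
    and u': "\<And>t. (u' has_real_derivative u'' t) (at t)"
    and u'': "continuous_on UNIV u''"
  shows C2_compose: "(\<lambda>x. u (f x)) \<in> C2"
    and grad_compose: "grad (\<lambda>x. u (f x)) = (\<lambda>x. u' (f x) *\<^sub>R grad f x)"
    and hess_compose: "hess (\<lambda>x. u (f x)) =
      (\<lambda>x. u' (f x) *\<^sub>R hess f x + u'' (f x) *\<^sub>R outer (grad f x) (grad f x))"
proof -
  have 1: "((\<lambda>x. u (f x)) has_derivative (\<lambda>h. (u' (f x) *\<^sub>R grad f x) \<bullet> h)) (at x)" for x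
    using has_derivative_compose[OF C2D(1)[OF f] u[unfolded has_field_derivative_def]]
    by (simp add: mult.commute)
  have d: "((\<lambda>x. u' (f x)) has_derivative (\<lambda>h. u'' (f x) * (grad f x \<bullet> h))) (at x)" for x
    using has_derivative_compose[OF C2D(1)[OF f] u'[unfolded has_field_derivative_def]]
    by simp
  have 2: "((\<lambda>x. u' (f x) *\<^sub>R grad f x) has_derivative
      (\<lambda>h. (u' (f x) *\<^sub>R hess f x + u'' (f x) *\<^sub>R outer (grad f x) (grad f x)) *v h)) (at x)" for x
    using d[of x] C2D(2)[OF f, of x]
    by (auto intro!: derivative_eq_intros
        simp: matrix_vector_mult_add_rdistrib scaleR_matrix_vec outer_mult_vec)
  have c: "continuous_on UNIV u'"
    using u' by (meson DERIV_isCont continuous_at_imp_continuous_on)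
  have 3: "continuous_on UNIV (\<lambda>x. u' (f x) *\<^sub>R hess f x + u'' (f x) *\<^sub>R outer (grad f x) (grad f x))"
    by (intro continuous_intros C2D f continuous_on_compose2[OF c] continuous_on_compose2[OF u'']) auto
  show "(\<lambda>x. u (f x)) \<in> C2" "grad (\<lambda>x. u (f x)) = (\<lambda>x. u' (f x) *\<^sub>R grad f x)"
    "hess (\<lambda>x. u (f x)) =
      (\<lambda>x. u' (f x) *\<^sub>R hess f x + u'' (f x) *\<^sub>R outer (grad f x) (grad f x))"
    using C2I[OF 1 2 3] by auto
qed

lemma C2_real_polynomial_function:
  fixes p :: "real^'d \<Rightarrow> real"
  assumes "real_polynomial_function p"
  shows "p \<in> C2"
  using assms
proof induction
  case (linear f)
  \<comment> \<open>A linear functional is the inner product with the vector of its values on the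
    standard basis, which reduces this case to \<open>C2_inner\<close>.\<close>
  have "f = (\<lambda>x. (\<chi> i. f (axis i 1)) \<bullet> x)"
  proof
    fix x
    have lin: "linear f" using linear bounded_linear.linear by blast
    have "f x = f (\<Sum>i\<in>UNIV. (x $ i) *s axis i 1)" by (simp add: basis_expansion)
    also have "\<dots> = (\<Sum>i\<in>UNIV. (x $ i) * f (axis i 1))"
      by (simp add: linear_sum[OF lin] scalar_mult_eq_scaleR linear_cmul[OF lin])
    finally show "f x = (\<chi> i. f (axis i 1)) \<bullet> x" by (simp add: inner_vec_def mult.commute)
  qed
  thus ?case by (metis C2_inner(1))
qed (auto intro: C2_const C2_add C2_mult)

section \<open>Compact support and the weighted norm\<close>

lemma bounded_range_if_vanishes_outside:
  fixes F :: "'a::euclidean_space \<Rightarrow> 'b::real_normed_vector"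
  assumes "continuous_on UNIV F" "\<And>x. norm x > N \<Longrightarrow> F x = 0"
  shows "bounded (range F)"
proof -
  have "compact (F ` cball 0 N)"
    using assms(1) by (intro compact_continuous_image continuous_on_subset[OF assms(1)]) auto
  moreover have "range F \<subseteq> insert 0 (F ` cball 0 N)"
    using assms(2) by (force simp: not_le)
  ultimately show ?thesis
    by (meson bounded_insert bounded_subset compact_imp_bounded)
qed

text \<open>In a Euclidean space a closure is compact exactly when the set is bounded. Vanishing
  beyond some radius is the form in which compact support is used from here on.\<close>

lemma C2c_iff: "f \<in> C2c \<longleftrightarrow> f \<in> C2 \<and> (\<exists>N. \<forall>x. norm x > N \<longrightarrow> f x = 0)"
proof -
  have "compact (closure {x. f x \<noteq> 0}) \<longleftrightarrow> (\<exists>N. \<forall>x. norm x > N \<longrightarrow> f x = 0)"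
    unfolding compact_closure bounded_iff Ball_def mem_Collect_eq not_le[symmetric] by blast
  thus ?thesis by (auto simp: C2c_def)
qed

text \<open>The exterior of a closed ball is open, so near each of its points the function coincides
  with 0 and uniqueness of derivatives applies, twice.\<close>

lemma C2_vanish_derivatives:
  assumes "f \<in> C2" and z: "\<And>x. norm x > N \<Longrightarrow> f x = 0" and x: "norm x > N"
  shows "grad f x = 0" "hess f x = 0"
proof -
  let ?U = "- cball (0::real^'a) N"
  have U: "open ?U" by auto
  have g: "grad f y = 0" if "y \<in> ?U" for y
  proof -
    have "((\<lambda>x. 0::real) has_derivative (\<lambda>h. grad f y \<bullet> h)) (at y)"
      by (rule has_derivative_transform_within_open[OF C2D(1)[OF assms(1)] U that]) (auto intro: z)
    hence "(\<lambda>h. grad f y \<bullet> h) = (\<lambda>h. 0)"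
      using has_derivative_const has_derivative_unique by blast
    thus ?thesis by (metis inner_eq_zero_iff)
  qed
  thus "grad f x = 0" using x by auto
  have "((\<lambda>x. 0::real^'a) has_derivative (\<lambda>h. hess f x *v h)) (at x)"
    by (rule has_derivative_transform_within_open[OF C2D(2)[OF assms(1)] U]) (use x g in auto)
  hence "(\<lambda>h. hess f x *v h) = (\<lambda>h. 0 *v h)"
    using has_derivative_const has_derivative_unique by (metis matrix_vector_mult_0)
  thus "hess f x = 0" by (metis matrix_eq)
qed

lemma bounded_nonneg_range:
  fixes u :: "'a \<Rightarrow> real"
  assumes "\<And>x. 0 \<le> u x" "\<And>x. u x \<le> c"
  shows "bounded (range u)"
  using assms by (auto simp: bounded_iff intro!: exI[of _ c])

text \<open>Norm estimates are reduced to pointwise bounds on the three terms. The same bounds yield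
  membership in \<open>C2w\<close>, where the suprema in \<open>norm_w\<close> are genuine.\<close>

lemma C2wI:
  assumes "f \<in> C2" "\<And>x. \<bar>f x\<bar> \<le> a" "\<And>x. (1 + norm x) * norm (grad f x) \<le> b"
    "\<And>x. (1 + (norm x)\<^sup>2) * norm (hess f x) \<le> c"
  shows "f \<in> C2w" "norm_w f \<le> a + b + c"
proof -
  show "f \<in> C2w"
    using assms(1,2) bounded_nonneg_range[OF _ assms(3)] bounded_nonneg_range[OF _ assms(4)]
    by (auto simp: C2w_def bounded_iff)
  show "norm_w f \<le> a + b + c"
    unfolding norm_w_def by (intro add_mono cSUP_least assms) auto
qed

lemma C2wD:
  assumes "f \<in> C2w"
  shows "f \<in> C2" "\<bar>f x\<bar> \<le> (SUP x. \<bar>f x\<bar>)"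
    "(1 + norm x) * norm (grad f x) \<le> (SUP x. (1 + norm x) * norm (grad f x))"
    "(1 + (norm x)\<^sup>2) * norm (hess f x) \<le> (SUP x. (1 + (norm x)\<^sup>2) * norm (hess f x))"
    "0 \<le> (SUP x. \<bar>f x\<bar>)"
    "0 \<le> (SUP x. (1 + norm x) * norm (grad f x))"
    "0 \<le> (SUP x. (1 + (norm x)\<^sup>2) * norm (hess f x))"
proof -
  have b: "bounded (range (\<lambda>x. \<bar>f x\<bar>))"
    using assms by (auto simp: C2w_def bounded_iff)
  show "f \<in> C2" using assms by (simp add: C2w_def)
  show "\<bar>f x\<bar> \<le> (SUP x. \<bar>f x\<bar>)" "0 \<le> (SUP x. \<bar>f x\<bar>)"
    using bounded_nonneg_SUP_ge[OF b] by auto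
  show "(1 + norm x) * norm (grad f x) \<le> (SUP x. (1 + norm x) * norm (grad f x))"
    "0 \<le> (SUP x. (1 + norm x) * norm (grad f x))"
    "(1 + (norm x)\<^sup>2) * norm (hess f x) \<le> (SUP x. (1 + (norm x)\<^sup>2) * norm (hess f x))"
    "0 \<le> (SUP x. (1 + (norm x)\<^sup>2) * norm (hess f x))"
    using assms bounded_nonneg_SUP_ge[of "\<lambda>x. (1 + norm x) * norm (grad f x)"]
      bounded_nonneg_SUP_ge[of "\<lambda>x. (1 + (norm x)\<^sup>2) * norm (hess f x)"]
    by (auto simp: C2w_def)
qed

lemma norm_w_nonneg: "f \<in> C2w \<Longrightarrow> 0 \<le> norm_w f"
  using C2wD(5-7)[of f] by (simp add: norm_w_def)

text \<open>The weight of the gradient is at least 1, so the plain gradient is bounded too; this is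
  the source of the Lipschitz bound on the unit ball.\<close>

lemma norm_w_ge:
  assumes "f \<in> C2w"
  shows "\<bar>f x\<bar> \<le> norm_w f" "norm (grad f x) \<le> norm_w f"
proof -
  have "norm (grad f x) \<le> (1 + norm x) * norm (grad f x)" by (simp add: algebra_simps)
  thus "\<bar>f x\<bar> \<le> norm_w f" "norm (grad f x) \<le> norm_w f"
    using C2wD(2)[OF assms, of x] C2wD(3)[OF assms, of x] C2wD(5-7)[OF assms]
    unfolding norm_w_def by linarith+
qed

lemma
  assumes f: "f \<in> C2w" and g: "g \<in> C2w"
  shows C2w_add: "(\<lambda>x. f x + g x) \<in> C2w"
    and norm_w_triangle: "norm_w (\<lambda>x. f x + g x) \<le> norm_w f + norm_w g"
proof -
  note F = C2wD[OF f] and G = C2wD[OF g]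
  have 1: "\<bar>f x + g x\<bar> \<le> (SUP x. \<bar>f x\<bar>) + (SUP x. \<bar>g x\<bar>)" for x
    using F(2)[of x] G(2)[of x] by linarith
  have 2: "(1 + norm x) * norm (grad (\<lambda>x. f x + g x) x) \<le>
      (SUP x. (1 + norm x) * norm (grad f x)) + (SUP x. (1 + norm x) * norm (grad g x))" for x
  proof -
    have "(1 + norm x) * norm (grad f x + grad g x) \<le> (1 + norm x) * (norm (grad f x) + norm (grad g x))"
      by (intro mult_left_mono norm_triangle_ineq) auto
    thus ?thesis using F(3)[of x] G(3)[of x] grad_add[OF F(1) G(1)] by (simp add: distrib_left)
  qed
  have 3: "(1 + (norm x)\<^sup>2) * norm (hess (\<lambda>x. f x + g x) x) \<le>
      (SUP x. (1 + (norm x)\<^sup>2) * norm (hess f x)) + (SUP x. (1 + (norm x)\<^sup>2) * norm (hess g x))" for x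
  proof -
    have "(1 + (norm x)\<^sup>2) * norm (hess f x + hess g x) \<le> (1 + (norm x)\<^sup>2) * (norm (hess f x) + norm (hess g x))"
      by (intro mult_left_mono norm_triangle_ineq) auto
    thus ?thesis using F(4)[of x] G(4)[of x] hess_add[OF F(1) G(1)] by (simp add: distrib_left)
  qed
  from C2wI[OF C2_add[OF F(1) G(1)] 1 2 3]
  show "(\<lambda>x. f x + g x) \<in> C2w" "norm_w (\<lambda>x. f x + g x) \<le> norm_w f + norm_w g"
    unfolding norm_w_def by auto
qed

lemma
  assumes f: "f \<in> C2w"
  shows C2w_cmult: "(\<lambda>x. c * f x) \<in> C2w"
    and norm_w_cmult_le: "norm_w (\<lambda>x. c * f x) \<le> \<bar>c\<bar> * norm_w f"
proof -
  note F = C2wD[OF f]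
  have 1: "\<bar>c * f x\<bar> \<le> \<bar>c\<bar> * (SUP x. \<bar>f x\<bar>)" for x
    using mult_left_mono[OF F(2)[of x], of "\<bar>c\<bar>"] by (simp add: abs_mult)
  have 2: "(1 + norm x) * norm (grad (\<lambda>x. c * f x) x) \<le>
      \<bar>c\<bar> * (SUP x. (1 + norm x) * norm (grad f x))" for x
    using mult_left_mono[OF F(3)[of x], of "\<bar>c\<bar>"] by (simp add: grad_cmult[OF F(1)] mult_ac)
  have 3: "(1 + (norm x)\<^sup>2) * norm (hess (\<lambda>x. c * f x) x) \<le>
      \<bar>c\<bar> * (SUP x. (1 + (norm x)\<^sup>2) * norm (hess f x))" for x
    using mult_left_mono[OF F(4)[of x], of "\<bar>c\<bar>"] by (simp add: hess_cmult[OF F(1)] mult_ac)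
  from C2wI[OF C2_cmult[OF F(1)] 1 2 3]
  show "(\<lambda>x. c * f x) \<in> C2w" "norm_w (\<lambda>x. c * f x) \<le> \<bar>c\<bar> * norm_w f"
    unfolding norm_w_def by (auto simp: distrib_left)
qed

lemma C2w_diff: "f \<in> C2w \<Longrightarrow> g \<in> C2w \<Longrightarrow> (\<lambda>x. f x - g x) \<in> C2w"
  using C2w_add[of f "\<lambda>x. -1 * g x"] C2w_cmult[of g "-1"] by simp

lemma norm_w_diff_commute:
  assumes "f \<in> C2w" "g \<in> C2w"
  shows "norm_w (\<lambda>x. f x - g x) = norm_w (\<lambda>x. g x - f x)"
proof (rule antisym)
  show "norm_w (\<lambda>x. f x - g x) \<le> norm_w (\<lambda>x. g x - f x)"
    using norm_w_cmult_le[OF C2w_diff[OF assms(2,1)], of "-1"] by simp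
  show "norm_w (\<lambda>x. g x - f x) \<le> norm_w (\<lambda>x. f x - g x)"
    using norm_w_cmult_le[OF C2w_diff[OF assms], of "-1"] by simp
qed

lemma norm_w_diff_triangle:
  assumes "f \<in> C2w" "g \<in> C2w" "h \<in> C2w"
  shows "norm_w (\<lambda>x. f x - h x) \<le> norm_w (\<lambda>x. f x - g x) + norm_w (\<lambda>x. g x - h x)"
  using norm_w_triangle[OF C2w_diff[OF assms(1,2)] C2w_diff[OF assms(2,3)]] by simp

lemma norm_w_le_add_diff:
  assumes "f \<in> C2w" "g \<in> C2w"
  shows "norm_w f \<le> norm_w g + norm_w (\<lambda>x. f x - g x)"
  using norm_w_triangle[OF assms(2) C2w_diff[OF assms]] by simp

lemma norm_w_zero: "norm_w (\<lambda>x. 0 :: real) = 0"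
  by (simp add: norm_w_def C2_const)

lemma C2c_cmult: "f \<in> C2c \<Longrightarrow> (\<lambda>x. c * f x) \<in> C2c"
  unfolding C2c_iff using C2_cmult by (metis mult_zero_right)

lemma C2c_subset_C2w: "C2c \<subseteq> C2w"
proof
  fix f :: "real^'a \<Rightarrow> real" assume "f \<in> C2c"
  then obtain N where f: "f \<in> C2" and N: "\<And>x. norm x > N \<Longrightarrow> f x = 0" by (auto simp: C2c_iff)
  note v = C2_vanish_derivatives[OF f N]
  have "bounded (range f)"
    by (rule bounded_range_if_vanishes_outside[OF C2D(3)[OF f] N])
  moreover have "bounded (range (\<lambda>x. (1 + norm x) * norm (grad f x)))"
    by (rule bounded_range_if_vanishes_outside[of _ N]) (intro continuous_intros C2D f, simp add: v)
  moreover have "bounded (range (\<lambda>x. (1 + (norm x)\<^sup>2) * norm (hess f x)))"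
    by (rule bounded_range_if_vanishes_outside[of _ N]) (intro continuous_intros C2D f, simp add: v)
  ultimately show "f \<in> C2w" using f by (simp add: C2w_def)
qed

lemma C2c_subset_C20w: "C2c \<subseteq> C20w"
  using C2c_subset_C2w by (force simp: C20w_def closure_w_def norm_w_zero)

lemma C20w_subset_C2w: "C20w \<subseteq> C2w"
  by (auto simp: C20w_def closure_w_def)

lemma C20w_cmult:
  assumes "f \<in> C20w"
  shows "(\<lambda>x. c * f x) \<in> C20w"
  unfolding C20w_def closure_w_def mem_Collect_eq
proof (intro conjI allI impI)
  have f: "f \<in> C2w" using assms C20w_subset_C2w by blast
  show "(\<lambda>x. c * f x) \<in> C2w" by (rule C2w_cmult[OF f])
  fix e :: real assume "e > 0"
  \<comment> \<open>The summand 1 covers \<open>c = 0\<close>.\<close>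
  hence "e / (\<bar>c\<bar> + 1) > 0" by (simp add: add_nonneg_pos)
  then obtain g where g: "g \<in> C2c" "norm_w (\<lambda>x. f x - g x) < e / (\<bar>c\<bar> + 1)"
    using assms by (auto simp: C20w_def closure_w_def)
  have fg: "(\<lambda>x. f x - g x) \<in> C2w" using f g C2c_subset_C2w C2w_diff by blast
  have "norm_w (\<lambda>x. c * f x - c * g x) \<le> \<bar>c\<bar> * norm_w (\<lambda>x. f x - g x)"
    using norm_w_cmult_le[OF fg, of c] by (simp add: algebra_simps)
  also have "\<dots> \<le> (\<bar>c\<bar> + 1) * norm_w (\<lambda>x. f x - g x)"
    using norm_w_nonneg[OF fg] by (intro mult_right_mono) auto
  also have "\<dots> < e"
    using g(2) by (simp add: pos_less_divide_eq mult.commute add_nonneg_pos)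
  finally show "\<exists>h\<in>C2c. norm_w (\<lambda>x. c * f x - h x) < e"
    using C2c_cmult[OF g(1), of c] by (intro bexI[of _ "\<lambda>x. c * g x"])
qed

section \<open>From \<open>D2w\<close> to narrow convergence\<close>

lemma MplusD:
  assumes "\<mu> \<in> Mplus"
  shows "finite_measure \<mu>" "sets \<mu> = sets borel" "space \<mu> = UNIV"
    "emeasure \<mu> (space \<mu>) \<noteq> \<infinity>"
proof -
  show f: "finite_measure \<mu>" and s: "sets \<mu> = sets borel" using assms by (auto simp: Mplus_def)
  show "space \<mu> = UNIV" using sets_eq_imp_space_eq[OF s] by simp
  show "emeasure \<mu> (space \<mu>) \<noteq> \<infinity>" using finite_measure.finite_emeasure_space[OF f] by simp
qed

lemma integrable_Mplus:
  fixes f :: "real^'d \<Rightarrow> real"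
  assumes "\<mu> \<in> Mplus" "continuous_on UNIV f" "\<And>x. \<bar>f x\<bar> \<le> B"
  shows "integrable \<mu> f"
proof -
  interpret finite_measure \<mu> using assms by (simp add: MplusD)
  have "f \<in> borel_measurable \<mu>"
    using borel_measurable_continuous_onI[OF assms(2)] measurable_cong_sets[OF MplusD(2)[OF assms(1)] refl]
    by blast
  thus ?thesis using assms(3) by (intro integrable_const_bound[of _ B]) auto
qed

lemma integrable_C2w: "\<mu> \<in> Mplus \<Longrightarrow> f \<in> C2w \<Longrightarrow> integrable \<mu> f"
  by (rule integrable_Mplus[OF _ C2D(3)[OF C2wD(1)] norm_w_ge(1)])

lemma integral_diff_le:
  fixes f g :: "'a \<Rightarrow> real"
  assumes "finite_measure \<mu>" "integrable \<mu> f" "integrable \<mu> g" "\<And>x. \<bar>f x - g x\<bar> \<le> B"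
  shows "\<bar>(\<integral>x. f x \<partial>\<mu>) - (\<integral>x. g x \<partial>\<mu>)\<bar> \<le> B * measure \<mu> (space \<mu>)"
proof -
  interpret finite_measure \<mu> by fact
  have "\<bar>(\<integral>x. f x \<partial>\<mu>) - (\<integral>x. g x \<partial>\<mu>)\<bar> = \<bar>\<integral>x. f x - g x \<partial>\<mu>\<bar>" using assms by simp
  also have "\<dots> \<le> (\<integral>x. \<bar>f x - g x\<bar> \<partial>\<mu>)" by (rule integral_abs_bound)
  also have "\<dots> \<le> (\<integral>x. B \<partial>\<mu>)" using assms by (intro integral_mono) auto
  finally show ?thesis by (simp add: mult.commute)
qed

lemma D2w_eq:
  "\<mu> \<in> Mplus \<Longrightarrow> \<nu> \<in> Mplus \<Longrightarrow> D2w \<mu> \<nu> = (SUP \<phi>\<in>ball_w. \<bar>(\<integral>x. \<phi> x \<partial>\<mu>) - (\<integral>x. \<phi> x \<partial>\<nu>)\<bar>)"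
  by (simp add: D2w_def)

lemma D2w_upper:
  assumes "\<mu> \<in> Mplus" "\<nu> \<in> Mplus" "\<phi> \<in> ball_w"
  shows "\<bar>(\<integral>x. \<phi> x \<partial>\<mu>) - (\<integral>x. \<phi> x \<partial>\<nu>)\<bar> \<le> D2w \<mu> \<nu>"
  unfolding D2w_eq[OF assms(1,2)] using bdd_above_D2w[OF assms(1,2)] assms(3) by (rule cSUP_upper2) simp

lemma D2w_least:
  assumes "\<mu> \<in> Mplus" "\<nu> \<in> Mplus"
    "\<And>\<phi>. \<phi> \<in> ball_w \<Longrightarrow> \<bar>(\<integral>x. \<phi> x \<partial>\<mu>) - (\<integral>x. \<phi> x \<partial>\<nu>)\<bar> \<le> B"
  shows "D2w \<mu> \<nu> \<le> B"
  unfolding D2w_eq[OF assms(1,2)] using ball_w_nonempty assms(3) by (rule cSUP_least)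

lemma D2w_nonneg: "0 \<le> D2w \<mu> \<nu>"
proof (cases "\<mu> \<in> Mplus \<and> \<nu> \<in> Mplus")
  case True
  obtain \<phi> :: "real^'a \<Rightarrow> real" where "\<phi> \<in> ball_w" using ball_w_nonempty by blast
  thus ?thesis using D2w_upper True by (meson abs_ge_zero order_trans)
qed (auto simp: D2w_def)

lemma D2w_commute: "D2w \<mu> \<nu> = D2w \<nu> \<mu>"
  by (simp add: D2w_def abs_minus_commute conj_commute)

lemma D2w_triangle:
  assumes "\<mu> \<in> Mplus" "\<nu> \<in> Mplus" "\<rho> \<in> Mplus"
  shows "D2w \<mu> \<rho> \<le> D2w \<mu> \<nu> + D2w \<nu> \<rho>"
proof (rule D2w_least[OF assms(1,3)])
  fix \<phi> :: "real^'a \<Rightarrow> real" assume "\<phi> \<in> ball_w"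
  from D2w_upper[OF assms(1,2) this] D2w_upper[OF assms(2,3) this]
  show "\<bar>(\<integral>x. \<phi> x \<partial>\<mu>) - (\<integral>x. \<phi> x \<partial>\<rho>)\<bar> \<le> D2w \<mu> \<nu> + D2w \<nu> \<rho>" by linarith
qed

text \<open>Scaling by \<open>inverse C\<close> moves \<open>f\<close> into the unit ball. A
  positive upper bound \<open>C\<close> replaces \<open>norm_w f\<close>, which may be 0.\<close>

lemma D2w_bound:
  assumes M: "\<mu> \<in> Mplus" "\<nu> \<in> Mplus" and f: "f \<in> C20w" "norm_w f \<le> C" "C > 0"
  shows "\<bar>(\<integral>x. f x \<partial>\<mu>) - (\<integral>x. f x \<partial>\<nu>)\<bar> \<le> C * D2w \<mu> \<nu>"
proof -
  have w: "f \<in> C2w" using f C20w_subset_C2w by blast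
  have "norm_w (\<lambda>x. inverse C * f x) \<le> \<bar>inverse C\<bar> * norm_w f" by (rule norm_w_cmult_le[OF w])
  also have "\<dots> \<le> 1" using f(2,3) by (simp add: field_simps)
  finally have "(\<lambda>x. inverse C * f x) \<in> ball_w" using C20w_cmult[OF f(1)] by (simp add: ball_w_def)
  from D2w_upper[OF M this]
  have "\<bar>inverse C * ((\<integral>x. f x \<partial>\<mu>) - (\<integral>x. f x \<partial>\<nu>))\<bar> \<le> D2w \<mu> \<nu>" by (simp add: algebra_simps)
  thus ?thesis using f(3) by (simp add: abs_mult field_simps)
qed

text \<open>The cube is the lowest integer power of the positive part that is twice continuously
  differentiable; squaring \<open>norm x / R\<close> keeps the function smooth at the
  origin.\<close>

definition cutoff :: "real \<Rightarrow> real^'d \<Rightarrow> real" where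
  "cutoff R x = (max 0 (1 - (norm x / R)\<^sup>2)) ^ 3"

text \<open>Away from 0 the function is locally a power or constant. At the junction the difference
  quotient is at most \<open>\<bar>h\<bar> ^ n\<close>, which tends to 0 since
  \<open>n \<ge> 1\<close>.\<close>

lemma pos_part_power_deriv:
  assumes "n \<ge> 1"
  shows "((\<lambda>t::real. (max 0 t) ^ Suc n) has_real_derivative real (Suc n) * (max 0 t) ^ n) (at t)"
proof -
  consider "t > 0" | "t < 0" | "t = 0" by linarith
  thus ?thesis
  proof cases
    case 1
    have "((\<lambda>t::real. t ^ Suc n) has_real_derivative real (Suc n) * t ^ n) (at t)"
      by (rule derivative_eq_intros refl | simp)+
    hence "((\<lambda>t::real. (max 0 t) ^ Suc n) has_real_derivative real (Suc n) * t ^ n) (at t)"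
      by (rule has_field_derivative_transform_within_open[of _ _ _ "{0<..}"]) (use 1 in \<open>auto simp: max_def\<close>)
    thus ?thesis using 1 by (simp add: max_def)
  next
    case 2
    have "((\<lambda>t::real. 0) has_real_derivative 0) (at t)" by simp
    hence "((\<lambda>t::real. (max 0 t) ^ Suc n) has_real_derivative 0) (at t)"
      by (rule has_field_derivative_transform_within_open[of _ _ _ "{..<0}"]) (use 2 in \<open>auto simp: max_def\<close>)
    thus ?thesis using 2 assms by (simp add: max_def power_0_left)
  next
    case 3
    have "((\<lambda>h::real. \<bar>h\<bar> ^ n) \<longlongrightarrow> \<bar>0\<bar> ^ n) (at 0)" by (intro tendsto_intros)
    hence l: "((\<lambda>h::real. \<bar>h\<bar> ^ n) \<longlongrightarrow> 0) (at 0)" using assms by (simp add: power_0_left)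
    have "((\<lambda>h::real. (max 0 (0 + h) ^ Suc n - max 0 0 ^ Suc n) / h) \<longlongrightarrow> 0) (at 0)"
    proof (rule Lim_null_comparison[OF _ l], rule always_eventually, rule allI)
      fix h :: real
      show "norm ((max 0 (0 + h) ^ Suc n - max 0 0 ^ Suc n) / h) \<le> \<bar>h\<bar> ^ n"
        by (cases "h > 0") (auto simp: max_def)
    qed
    thus ?thesis using 3 assms by (simp add: DERIV_def power_0_left)
  qed
qed

text \<open>The three terms contribute 1, 12 and \<open>48 + 12 * norm (mat 1)\<close>, whose sum is
  free of \<open>R\<close>. The norm of the identity matrix is the square root of the dimension and
  is left unevaluated.\<close>

lemma
  fixes R :: real
  assumes R: "R \<ge> 1"
  shows cutoff_C2c: "(cutoff R :: real^'d \<Rightarrow> real) \<in> C2c"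
    and norm_w_cutoff_le: "norm_w (cutoff R :: real^'d \<Rightarrow> real) \<le> 61 + 12 * norm (mat 1 :: real^'d^'d)"
proof -
  define q :: "real^'d \<Rightarrow> real" where "q x = 1 - (norm x / R)\<^sup>2" for x
  have qe: "q x = 1 - inverse (R\<^sup>2) * (x \<bullet> x)" for x
    unfolding q_def power_divide power2_norm_eq_inner by (simp add: divide_inverse_commute)
  have d1: "(q has_derivative (\<lambda>h. (- (2 / R\<^sup>2) *\<^sub>R x) \<bullet> h)) (at x)" for x
    unfolding qe[abs_def]
    by (auto intro!: derivative_eq_intros simp: inner_commute divide_inverse algebra_simps)
  have d2: "((\<lambda>x. - (2 / R\<^sup>2) *\<^sub>R x) has_derivative (\<lambda>h. (- (2 / R\<^sup>2) *\<^sub>R mat 1) *v h)) (at x)" for x :: "real^'d"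
    by (auto intro!: derivative_eq_intros simp: scaleR_matrix_vec simp del: scaleR_minus_left)
  note q = C2I[OF d1 d2 continuous_on_const]
  define u where "u t = (max 0 t) ^ 3" for t :: real
  define u' where "u' t = 3 * (max 0 t) ^ 2" for t :: real
  define u'' where "u'' t = 6 * max 0 t" for t :: real
  have u: "(u has_real_derivative u' t) (at t)" for t
    using pos_part_power_deriv[of 2 t] by (simp add: u_def[abs_def] u'_def eval_nat_numeral)
  have u': "(u' has_real_derivative u'' t) (at t)" for t
    using DERIV_cmult[OF pos_part_power_deriv[of 1 t], of 3]
    by (simp add: u'_def[abs_def] u''_def eval_nat_numeral)
  have u'': "continuous_on UNIV u''" unfolding u''_def by (intro continuous_intros)
  have e: "cutoff R = (\<lambda>x. u (q x))" by (auto simp: cutoff_def u_def q_def)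
  have c2: "(cutoff R :: real^'d \<Rightarrow> real) \<in> C2"
    unfolding e by (rule C2_compose[OF q(1) u u' u''])
  have g: "grad (cutoff R) x = u' (q x) *\<^sub>R (- (2 / R\<^sup>2) *\<^sub>R x)" for x :: "real^'d"
    unfolding e grad_compose[OF q(1) u u' u''] q(2) ..
  have h: "hess (cutoff R) x = u' (q x) *\<^sub>R (- (2 / R\<^sup>2) *\<^sub>R mat 1) +
      u'' (q x) *\<^sub>R outer (- (2 / R\<^sup>2) *\<^sub>R x) (- (2 / R\<^sup>2) *\<^sub>R x)" for x :: "real^'d"
    unfolding e hess_compose[OF q(1) u u' u''] q(2,3) ..
  have out: "q x \<le> 0" if "norm x > R" for x
  proof -
    have "1 \<le> norm x / R" using that R by simp
    thus ?thesis by (simp add: q_def one_le_power)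
  qed
  show "(cutoff R :: real^'d \<Rightarrow> real) \<in> C2c"
    unfolding C2c_iff using c2 out by (auto simp: e u_def max_absorb1 intro!: exI[of _ R])
  have q1: "max 0 (q x) \<le> 1" "0 \<le> max 0 (q x)" for x by (auto simp: q_def)
  have b1: "\<bar>cutoff R x\<bar> \<le> 1" for x :: "real^'d"
    using power_le_one[OF q1(2)[of x] q1(1)[of x], of 3] by (simp add: e u_def)
  have u'b: "0 \<le> u' (q x)" "u' (q x) \<le> 3" and u''b: "0 \<le> u'' (q x)" "u'' (q x) \<le> 6" for x
    using power_le_one[OF q1(2)[of x] q1(1)[of x], of 2] q1[of x] by (auto simp: u'_def u''_def)
  \<comment> \<open>On the ball of radius \<open>R \<ge> 1\<close> the weight is at most
    \<open>2 * R\<close>, the outer derivative \<open>u'\<close> at most 3, and the gradient of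
    \<open>q\<close> at most \<open>2 / R\<close>.\<close>
  have b2: "(1 + norm x) * norm (grad (cutoff R) x) \<le> 12" for x :: "real^'d"
  proof (cases "norm x \<le> R")
    case True
    have "(1 + norm x) * norm (grad (cutoff R) x) = (1 + norm x) * (u' (q x) * (2 / R\<^sup>2 * norm x))"
      using u'b[of x] by (simp add: g abs_mult)
    also have "\<dots> \<le> (2 * R) * (3 * (2 / R\<^sup>2 * R))"
      using True R u'b[of x] by (intro mult_mono mult_nonneg_nonneg) auto
    also have "\<dots> = 12" using R by (simp add: power2_eq_square)
    finally show ?thesis .
  qed (use out[of x] in \<open>auto simp: g u'_def max_absorb1\<close>)
  \<comment> \<open>Here the weight is at most \<open>2 * R\<^sup>2\<close>. The Hessian of
    \<open>q\<close> enters with factor \<open>u' \<le> 3\<close>, the square of its gradient with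
    \<open>u'' \<le> 6\<close>; together they give
    \<open>(6 * norm (mat 1) + 24) / R\<^sup>2\<close>.\<close>
  have b3: "(1 + (norm x)\<^sup>2) * norm (hess (cutoff R) x) \<le> 48 + 12 * norm (mat 1 :: real^'d^'d)" for x :: "real^'d"
  proof (cases "norm x \<le> R")
    case True
    have x2: "(norm x)\<^sup>2 \<le> R\<^sup>2" using True by (intro power_mono) auto
    have "1 \<le> R\<^sup>2" using R by (simp add: one_le_power)
    have "norm (hess (cutoff R) x) \<le> u' (q x) * (2 / R\<^sup>2 * norm (mat 1 :: real^'d^'d)) +
        u'' (q x) * ((2 / R\<^sup>2 * norm x) * (2 / R\<^sup>2 * norm x))"
      unfolding h by (rule norm_triangle_le) (use u'b[of x] u''b[of x] in \<open>simp add: norm_outer\<close>)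
    also have "\<dots> \<le> 3 * (2 / R\<^sup>2 * norm (mat 1 :: real^'d^'d)) + 6 * ((2 / R\<^sup>2 * R) * (2 / R\<^sup>2 * R))"
      using True R u'b[of x] u''b[of x] by (intro add_mono mult_mono mult_nonneg_nonneg) auto
    also have "\<dots> = (6 * norm (mat 1 :: real^'d^'d) + 24) / R\<^sup>2"
      using R by (simp add: field_simps power2_eq_square)
    finally have "(1 + (norm x)\<^sup>2) * norm (hess (cutoff R) x) \<le>
        (2 * R\<^sup>2) * ((6 * norm (mat 1 :: real^'d^'d) + 24) / R\<^sup>2)"
      using x2 \<open>1 \<le> R\<^sup>2\<close> by (intro mult_mono) auto
    thus ?thesis using R by simp
  qed (use out[of x] in \<open>auto simp: h u'_def u''_def max_absorb1\<close>)
  show "norm_w (cutoff R :: real^'d \<Rightarrow> real) \<le> 61 + 12 * norm (mat 1 :: real^'d^'d)"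
    using C2wI(2)[OF c2 b1 b2 b3] by simp
qed

lemma cutoff_le_1: "0 \<le> cutoff R x" "cutoff R x \<le> 1"
  by (auto simp: cutoff_def power_le_one)

lemma continuous_cutoff: "R \<ge> 1 \<Longrightarrow> continuous_on A (cutoff R)"
  using C2D(3) cutoff_C2c by (auto simp: C2c_iff)

lemma cutoff_eq_0:
  assumes "R \<ge> 1" "norm x \<ge> R"
  shows "cutoff R x = 0"
proof -
  have "1 \<le> norm x / R" using assms by simp
  hence "1 \<le> (norm x / R)\<^sup>2" by (rule one_le_power)
  thus ?thesis by (simp add: cutoff_def max_absorb1)
qed

lemma integrable_cutoff: "\<mu> \<in> Mplus \<Longrightarrow> R \<ge> 1 \<Longrightarrow> integrable \<mu> (cutoff R)"
  by (rule integrable_Mplus[OF _ continuous_cutoff, of _ _ 1]) (auto simp: cutoff_le_1 abs_le_iff order_trans[OF _ cutoff_le_1(1)])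

text \<open>Dominated convergence with the constant 1, integrable because the measure is finite. The
  radius is \<open>Suc n\<close> because the facts on cutoffs ask for radii at least 1.\<close>

lemma cutoff_integral_tendsto:
  fixes \<mu> :: "(real^'d) measure"
  assumes "\<mu> \<in> Mplus"
  shows "(\<lambda>n. \<integral>x. cutoff (real (Suc n)) x \<partial>\<mu>) \<longlonglongrightarrow> measure \<mu> (space \<mu>)"
proof -
  interpret finite_measure \<mu> using assms by (simp add: MplusD)
  have "(\<lambda>n. \<integral>x. cutoff (real (Suc n)) x \<partial>\<mu>) \<longlonglongrightarrow> (\<integral>x. 1 \<partial>\<mu>)"
  proof (rule integral_dominated_convergence[where w = "\<lambda>x. 1"])
    show "AE x in \<mu>. (\<lambda>n. cutoff (real (Suc n)) x) \<longlonglongrightarrow> 1"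
    proof (rule AE_I2)
      fix x :: "real^'d"
      have "(\<lambda>n. (norm x / real (Suc n))) \<longlonglongrightarrow> 0" by (rule LIMSEQ_Suc[OF lim_const_over_n])
      hence "(\<lambda>n. cutoff (real (Suc n)) x) \<longlonglongrightarrow> (max 0 (1 - 0\<^sup>2)) ^ 3"
        unfolding cutoff_def by (intro tendsto_intros)
      thus "(\<lambda>n. cutoff (real (Suc n)) x) \<longlonglongrightarrow> 1" by simp
    qed
    show "cutoff (real (Suc n)) \<in> borel_measurable \<mu>" for n
      using integrable_cutoff[OF assms, of "real (Suc n)"] by auto
  qed (auto simp: cutoff_le_1)
  thus ?thesis by simp
qed

text \<open>The dimension lives in the type, so a constant that depends on it takes an
  \<open>itself\<close> argument.\<close>

definition cutoff_const :: "'d::finite itself \<Rightarrow> real" where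
  "cutoff_const _ = 61 + 12 * norm (mat 1 :: real^'d^'d)"

lemma cutoff_const_pos: "cutoff_const TYPE('d::finite) > 0"
  by (simp add: cutoff_const_def add_pos_nonneg)

lemma cutoff_integral_diff_le:
  fixes \<mu> \<nu> :: "(real^'d) measure"
  assumes "\<mu> \<in> Mplus" "\<nu> \<in> Mplus" "R \<ge> 1"
  shows "\<bar>(\<integral>x. cutoff R x \<partial>\<mu>) - (\<integral>x. cutoff R x \<partial>\<nu>)\<bar> \<le> cutoff_const TYPE('d) * D2w \<mu> \<nu>"
  using cutoff_C2c[OF assms(3)] norm_w_cutoff_le[OF assms(3)] C2c_subset_C20w
  by (intro D2w_bound assms cutoff_const_pos) (auto simp: cutoff_const_def)

lemma measure_diff_le_D2w:
  fixes \<mu> \<nu> :: "(real^'d) measure"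
  assumes "\<mu> \<in> Mplus" "\<nu> \<in> Mplus"
  shows "\<bar>measure \<mu> (space \<mu>) - measure \<nu> (space \<nu>)\<bar> \<le> cutoff_const TYPE('d) * D2w \<mu> \<nu>"
proof (rule LIMSEQ_le_const2)
  show "(\<lambda>n. \<bar>(\<integral>x. cutoff (real (Suc n)) x \<partial>\<mu>) - (\<integral>x. cutoff (real (Suc n)) x \<partial>\<nu>)\<bar>)
      \<longlonglongrightarrow> \<bar>measure \<mu> (space \<mu>) - measure \<nu> (space \<nu>)\<bar>"
    by (intro tendsto_intros cutoff_integral_tendsto assms)
qed (use cutoff_integral_diff_le[OF assms] in auto)

text \<open>With a cutoff \<open>c\<close>, split \<open>h\<close> into \<open>h * c\<close> and
  \<open>h * (1 - c)\<close>. The first part is uniformly close to a test function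
  \<open>p * c\<close>; the second integrates to at most \<open>B\<close> times the total mass minus
  the integral of \<open>c\<close>. Every quantity in the resulting bound converges.\<close>

theorem D2w_tendsto_imp_narrow_conv:
  fixes \<mu> :: "(real^'d) measure"
  assumes \<nu>: "\<And>i. \<nu> i \<in> Mplus" and \<mu>: "\<mu> \<in> Mplus" and lim: "((\<lambda>i. D2w (\<nu> i) \<mu>) \<longlongrightarrow> 0) F"
  shows "narrow_conv \<nu> \<mu> F"
  unfolding narrow_conv_def
proof (intro allI impI, elim conjE)
  fix h :: "real^'d \<Rightarrow> real" assume h: "continuous_on UNIV h" and "bounded (range h)"
  then obtain B where B: "B > 0" "\<And>x. \<bar>h x\<bar> \<le> B" by (auto simp: bounded_pos)
  let ?K = "cutoff_const TYPE('d)"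
  let ?m = "\<lambda>\<mu>. measure \<mu> (space \<mu>)"
  have L: "((\<lambda>i. \<integral>x. f x \<partial>\<nu> i) \<longlongrightarrow> (\<integral>x. f x \<partial>\<mu>)) F" if f: "f \<in> C2c" for f
  proof -
    have "f \<in> C2w" "f \<in> C20w" using f C2c_subset_C2w C2c_subset_C20w by auto
    note b = D2w_bound[OF \<nu> \<mu> this(2) _ add_nonneg_pos[OF norm_w_nonneg[OF this(1)] zero_less_one]]
    have "((\<lambda>i. (norm_w f + 1) * D2w (\<nu> i) \<mu>) \<longlongrightarrow> (norm_w f + 1) * 0) F"
      by (intro tendsto_intros lim)
    hence l: "((\<lambda>i. (norm_w f + 1) * D2w (\<nu> i) \<mu>) \<longlongrightarrow> 0) F" by simp
    have "((\<lambda>i. (\<integral>x. f x \<partial>\<nu> i) - (\<integral>x. f x \<partial>\<mu>)) \<longlongrightarrow> 0) F"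
      by (rule Lim_null_comparison[OF _ l]) (use b in \<open>auto intro!: always_eventually\<close>)
    thus ?thesis by (simp add: Lim_null[symmetric])
  qed
  have m: "((\<lambda>i. ?m (\<nu> i)) \<longlongrightarrow> ?m \<mu>) F"
  proof -
    have "((\<lambda>i. ?K * D2w (\<nu> i) \<mu>) \<longlongrightarrow> ?K * 0) F" by (intro tendsto_intros lim)
    hence l: "((\<lambda>i. ?K * D2w (\<nu> i) \<mu>) \<longlongrightarrow> 0) F" by simp
    have "((\<lambda>i. ?m (\<nu> i) - ?m \<mu>) \<longlongrightarrow> 0) F"
      by (rule Lim_null_comparison[OF _ l]) (use measure_diff_le_D2w[OF \<nu> \<mu>] in \<open>auto intro!: always_eventually\<close>)
    thus ?thesis by (simp add: Lim_null[symmetric])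
  qed
  show "((\<lambda>i. \<integral>x. h x \<partial>\<nu> i) \<longlongrightarrow> (\<integral>x. h x \<partial>\<mu>)) F"
  proof (rule tendstoI)
    fix e :: real assume e: "e > 0"
    \<comment> \<open>The final error stays below \<open>2 * d * (m + B + 1)\<close>, where
      \<open>m\<close> is the mass of the limit.\<close>
    define d where "d = e / (2 * ?m \<mu> + 2 * B + 4)"
    have pos: "2 * ?m \<mu> + 2 * B + 4 > 0" using B(1) measure_nonneg[of \<mu> "space \<mu>"] by linarith
    have d: "d > 0" using e pos by (simp add: d_def)
    have "\<forall>\<^sub>F n in sequentially. \<bar>(\<integral>x. cutoff (real (Suc n)) x \<partial>\<mu>) - ?m \<mu>\<bar> < d"
      using cutoff_integral_tendsto[OF \<mu>] d by (simp add: tendsto_iff dist_real_def)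
    \<comment> \<open>The radius is fixed by \<open>\<mu>\<close> alone; for \<open>\<nu> i\<close>
      the mass missed by this cutoff is controlled afterwards, because masses and cutoff integrals
      converge.\<close>
    then obtain n where n: "\<bar>(\<integral>x. cutoff (real (Suc n)) x \<partial>\<mu>) - ?m \<mu>\<bar> < d"
      by (auto simp: eventually_sequentially)
    define R where "R = real (Suc n)"
    have R: "R \<ge> 1" by (simp add: R_def)
    let ?c = "cutoff R :: real^'d \<Rightarrow> real"
    obtain p where p: "real_polynomial_function p" "\<And>x. x \<in> cball 0 R \<Longrightarrow> \<bar>h x - p x\<bar> < d"
      using Stone_Weierstrass_real_polynomial_function[OF compact_cball continuous_on_subset[OF h subset_UNIV] d]
      by metis
    define f where "f x = p x * ?c x" for x
    have f: "f \<in> C2c"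
    proof -
      have "f \<in> C2" unfolding f_def
        using C2_real_polynomial_function[OF p(1)] cutoff_C2c[OF R] by (intro C2_mult) (auto simp: C2c_iff)
      thus ?thesis using cutoff_eq_0[OF R, where 'a = 'd] unfolding C2c_iff
        by (intro conjI exI[of _ R]) (simp_all add: f_def less_imp_le)
    qed
    have fh: "\<bar>f x - h x * ?c x\<bar> \<le> d" for x
    proof (cases "norm x \<le> R")
      case True
      have "\<bar>f x - h x * ?c x\<bar> = \<bar>h x - p x\<bar> * ?c x"
        unfolding f_def abs_minus_commute[of "h x"] left_diff_distrib[symmetric] abs_mult using cutoff_le_1[of R x] by simp
      also have "\<dots> \<le> d * 1"
        using p(2)[of x] True d cutoff_le_1[of R x] by (intro mult_mono) auto
      finally show ?thesis by simp
    qed (use cutoff_eq_0[OF R, of x] d in \<open>auto simp: f_def\<close>)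
    have est: "\<bar>(\<integral>x. h x \<partial>\<rho>) - (\<integral>x. f x \<partial>\<rho>)\<bar> \<le> d * ?m \<rho> + B * (?m \<rho> - (\<integral>x. ?c x \<partial>\<rho>))"
      if \<rho>: "\<rho> \<in> Mplus" for \<rho>
    proof -
      interpret finite_measure \<rho> using MplusD(1)[OF \<rho>] .
      have [simp]: "integrable \<rho> h" by (rule integrable_Mplus[OF \<rho> h B(2)])
      have [simp]: "integrable \<rho> f" using integrable_C2w[OF \<rho>] f C2c_subset_C2w by blast
      have [simp]: "integrable \<rho> ?c" by (rule integrable_cutoff[OF \<rho> R])
      have "\<bar>h x * ?c x\<bar> \<le> B" for x
        using mult_mono[OF B(2)[of x] cutoff_le_1(2)[of R x]] cutoff_le_1(1)[of R x] B(1) by (simp add: abs_mult)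
      hence [simp]: "integrable \<rho> (\<lambda>x. h x * ?c x)"
        by (intro integrable_Mplus[OF \<rho> _, of _ B] continuous_intros h continuous_cutoff R)
      have 1: "\<bar>(\<integral>x. f x \<partial>\<rho>) - (\<integral>x. h x * ?c x \<partial>\<rho>)\<bar> \<le> d * ?m \<rho>"
        by (rule integral_diff_le[OF _ _ _ fh]) (auto intro: finite_measure_axioms)
      have "\<bar>(\<integral>x. h x \<partial>\<rho>) - (\<integral>x. h x * ?c x \<partial>\<rho>)\<bar> = \<bar>\<integral>x. h x * (1 - ?c x) \<partial>\<rho>\<bar>"
        by (simp add: right_diff_distrib)
      also have "\<dots> \<le> (\<integral>x. \<bar>h x * (1 - ?c x)\<bar> \<partial>\<rho>)" by (rule integral_abs_bound)
      also have "\<dots> \<le> (\<integral>x. B * (1 - ?c x) \<partial>\<rho>)"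
      proof (intro integral_mono)
        fix x
        show "\<bar>h x * (1 - ?c x)\<bar> \<le> B * (1 - ?c x)"
          using B(2)[of x] cutoff_le_1[of R x] unfolding abs_mult by (simp add: mult_right_mono)
      qed (simp_all add: right_diff_distrib)
      also have "\<dots> = B * (?m \<rho> - (\<integral>x. ?c x \<partial>\<rho>))" by simp
      finally show ?thesis using 1 by linarith
    qed
    \<comment> \<open>The bound on the side of \<open>\<nu> i\<close> is compared with its limit, in
      which the last summand is 0.\<close>
    have "((\<lambda>i. d * ?m (\<nu> i) + B * (?m (\<nu> i) - (\<integral>x. ?c x \<partial>\<nu> i)) + \<bar>(\<integral>x. f x \<partial>\<nu> i) - (\<integral>x. f x \<partial>\<mu>)\<bar>)
        \<longlongrightarrow> d * ?m \<mu> + B * (?m \<mu> - (\<integral>x. ?c x \<partial>\<mu>)) + \<bar>(\<integral>x. f x \<partial>\<mu>) - (\<integral>x. f x \<partial>\<mu>)\<bar>) F"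
      by (intro tendsto_intros m L f cutoff_C2c R)
    moreover have B1: "B * (?m \<mu> - (\<integral>x. ?c x \<partial>\<mu>)) \<le> B * d"
      using n B(1) unfolding R_def[symmetric] by (intro mult_left_mono) auto
    ultimately have ev: "\<forall>\<^sub>F i in F. d * ?m (\<nu> i) + B * (?m (\<nu> i) - (\<integral>x. ?c x \<partial>\<nu> i))
        + \<bar>(\<integral>x. f x \<partial>\<nu> i) - (\<integral>x. f x \<partial>\<mu>)\<bar> < d * ?m \<mu> + B * d + d"
      using d by (intro order_tendstoD(2)) auto
    have fin: "2 * (d * ?m \<mu> + B * d + d) < e"
    proof -
      have "2 * (d * ?m \<mu> + B * d + d) < (2 * ?m \<mu> + 2 * B + 4) * d" using d by (simp add: algebra_simps)
      also have "\<dots> = e" unfolding d_def using pos by simp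
      finally show ?thesis .
    qed
    show "\<forall>\<^sub>F i in F. dist (\<integral>x. h x \<partial>\<nu> i) (\<integral>x. h x \<partial>\<mu>) < e"
      using ev
    proof eventually_elim
      case (elim i)
      have "\<bar>(\<integral>x. h x \<partial>\<nu> i) - (\<integral>x. h x \<partial>\<mu>)\<bar> \<le> \<bar>(\<integral>x. h x \<partial>\<nu> i) - (\<integral>x. f x \<partial>\<nu> i)\<bar>
          + \<bar>(\<integral>x. f x \<partial>\<nu> i) - (\<integral>x. f x \<partial>\<mu>)\<bar> + \<bar>(\<integral>x. h x \<partial>\<mu>) - (\<integral>x. f x \<partial>\<mu>)\<bar>"
        by linarith
      also have "\<dots> \<le> (d * ?m (\<nu> i) + B * (?m (\<nu> i) - (\<integral>x. ?c x \<partial>\<nu> i)))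
          + \<bar>(\<integral>x. f x \<partial>\<nu> i) - (\<integral>x. f x \<partial>\<mu>)\<bar> + (d * ?m \<mu> + B * d)"
        using est[OF \<nu>, of i] order_trans[OF est[OF \<mu>] add_left_mono[OF B1]]
        by (intro add_mono order_refl)
      also have "\<dots> < (d * ?m \<mu> + B * d + d) + (d * ?m \<mu> + B * d)"
        using elim by (intro add_strict_right_mono)
      also have "\<dots> < e" using fin d by (simp add: algebra_simps)
      finally show ?case by (simp add: dist_real_def)
    qed
  qed
qed

section \<open>Separation of measures and the metric axioms\<close>

lemma narrow_conv_imp_integral_eq:
  fixes h :: "real^'d \<Rightarrow> real"
  assumes "narrow_conv (\<lambda>_. \<nu>) \<mu> sequentially" "continuous_on UNIV h" "\<And>x. \<bar>h x\<bar> \<le> B"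
  shows "(\<integral>x. h x \<partial>\<nu>) = (\<integral>x. h x \<partial>\<mu>)"
proof -
  have "bounded (range h)" using assms(3) by (auto simp: bounded_iff intro!: exI[of _ B])
  thus ?thesis using assms(1,2) unfolding narrow_conv_def by (metis LIMSEQ_const_iff)
qed

text \<open>Closed sets form an intersection-stable generator, and the indicator of a nonempty
  closed set is the pointwise limit of the continuous functions
  \<open>max 0 (1 - n * infdist x A)\<close>.\<close>

lemma Mplus_eqI:
  fixes \<mu> \<nu> :: "(real^'d) measure"
  assumes M: "\<mu> \<in> Mplus" "\<nu> \<in> Mplus"
    and eq: "\<And>h :: real^'d \<Rightarrow> real. continuous_on UNIV h \<Longrightarrow> (\<And>x. \<bar>h x\<bar> \<le> 1) \<Longrightarrow>
      (\<integral>x. h x \<partial>\<mu>) = (\<integral>x. h x \<partial>\<nu>)"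
  shows "\<mu> = \<nu>"
proof (rule measure_eqI_generator_eq[of "{A. closed A}" UNIV _ _ "\<lambda>_. UNIV"])
  show "sets \<mu> = sigma_sets UNIV {A. closed A}" "sets \<nu> = sigma_sets UNIV {A. closed A}"
    using M by (simp_all add: MplusD borel_eq_closed)
  show "Int_stable {A :: (real^'d) set. closed A}" by (auto simp: Int_stable_def)
  show "emeasure \<mu> UNIV \<noteq> \<infinity>" using MplusD(3,4)[OF M(1)] by simp
  fix A :: "(real^'d) set" assume "A \<in> {A. closed A}"
  hence A: "closed A" by simp
  let ?h = "\<lambda>n x. max 0 (1 - real n * infdist x A)"
  show "emeasure \<mu> A = emeasure \<nu> A"
  \<comment> \<open>The empty set is set apart because \<open>infdist x {}\<close> is 0 by
    convention, which would make every \<open>?h n\<close> equal to 1.\<close>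
  proof (cases "A = {}")
    case False
    have lim: "(\<lambda>n. \<integral>x. ?h n x \<partial>\<rho>) \<longlonglongrightarrow> measure \<rho> A" if \<rho>: "\<rho> \<in> Mplus" for \<rho>
    proof -
      interpret finite_measure \<rho> using MplusD(1)[OF \<rho>] .
      have As: "A \<in> sets \<rho>" using A MplusD(2)[OF \<rho>] by simp
      have "(\<lambda>n. \<integral>x. ?h n x \<partial>\<rho>) \<longlonglongrightarrow> (\<integral>x. indicator A x \<partial>\<rho>)"
      proof (rule integral_dominated_convergence[where w = "\<lambda>x. 1"])
        show "AE x in \<rho>. (\<lambda>n. ?h n x) \<longlonglongrightarrow> indicator A x"
        proof (rule AE_I2)
          fix x
          show "(\<lambda>n. ?h n x) \<longlonglongrightarrow> indicator A x"
          proof (cases "x \<in> A")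
            case out: False
            hence i: "infdist x A > 0"
              using A False by (metis infdist_nonneg in_closed_iff_infdist_zero less_eq_real_def)
            obtain N where N: "1 < real N * infdist x A" using reals_Archimedean3[OF i] by blast
            have "?h n x = 0" if "n \<ge> N" for n
            proof -
              have "real N * infdist x A \<le> real n * infdist x A" using that i by (intro mult_right_mono) auto
              thus ?thesis using N by simp
            qed
            hence "\<forall>\<^sub>F n in sequentially. ?h n x = 0" using eventually_sequentially by blast
            thus ?thesis using out by (simp add: tendsto_eventually)
          qed simp
        qed
        show "?h n \<in> borel_measurable \<rho>" for n
          by (rule borel_measurable_integrable, rule integrable_Mplus[OF \<rho>, of _ 1])
             (auto intro!: continuous_intros simp: infdist_nonneg)
      qed (use As in \<open>auto simp: infdist_nonneg\<close>)
      thus ?thesis using As by simp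
    qed
    have "(\<integral>x. ?h n x \<partial>\<mu>) = (\<integral>x. ?h n x \<partial>\<nu>)" for n
      by (rule eq) (auto intro!: continuous_intros simp: infdist_nonneg)
    hence "measure \<mu> A = measure \<nu> A" using lim[OF M(1)] lim[OF M(2)] LIMSEQ_unique by simp
    thus ?thesis using M by (simp add: MplusD finite_measure.emeasure_eq_measure)
  qed simp
qed auto

lemma D2w_eq_0_iff:
  assumes M: "\<mu> \<in> Mplus" "\<nu> \<in> Mplus"
  shows "D2w \<mu> \<nu> = 0 \<longleftrightarrow> \<mu> = \<nu>"
proof
  assume "D2w \<mu> \<nu> = 0"
  \<comment> \<open>The constant sequence \<open>\<mu>\<close> converges to \<open>\<nu>\<close> in
    distance, hence narrowly, so all integrals of bounded continuous functions agree.\<close>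
  hence "narrow_conv (\<lambda>_::nat. \<mu>) \<nu> sequentially"
    using M by (intro D2w_tendsto_imp_narrow_conv) auto
  thus "\<mu> = \<nu>" using narrow_conv_imp_integral_eq by (intro Mplus_eqI[OF M]) blast
next
  assume "\<mu> = \<nu>"
  thus "D2w \<mu> \<nu> = 0"
    using D2w_least[OF M, of 0] D2w_nonneg[of \<mu> \<nu>] by auto
qed

lemma Metric_space_Mplus: "Metric_space Mplus D2w"
  by unfold_locales (auto simp: D2w_nonneg D2w_commute D2w_eq_0_iff D2w_triangle)

lemma Prob_subset_Mplus: "Prob \<subseteq> Mplus"
  by (auto simp: Prob_def)

lemma Metric_space_Prob: "Metric_space Prob D2w"
  using Metric_space.subspace[OF Metric_space_Mplus Prob_subset_Mplus] .

section \<open>From narrow convergence to \<open>D2w\<close>\<close>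

lemma ball_w_C2w: "\<phi> \<in> ball_w \<Longrightarrow> \<phi> \<in> C2w"
  using C20w_subset_C2w by (auto simp: ball_w_def)

lemma ball_w_lipschitz:
  assumes "\<phi> \<in> ball_w"
  shows "\<bar>\<phi> x - \<phi> y\<bar> \<le> norm (x - y)"
proof -
  have w: "\<phi> \<in> C2w" "norm_w \<phi> \<le> 1" using assms ball_w_C2w by (auto simp: ball_w_def)
  have "norm (\<phi> x - \<phi> y) \<le> 1 * norm (x - y)"
  proof (rule differentiable_bound[of UNIV \<phi> "\<lambda>x h. grad \<phi> x \<bullet> h"])
    fix z
    show "(\<phi> has_derivative (\<lambda>h. grad \<phi> z \<bullet> h)) (at z within UNIV)"
      using C2D(1)[OF C2wD(1)[OF w(1)]] by simp
    have "norm (grad \<phi> z \<bullet> h) \<le> norm h" for h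
      using Cauchy_Schwarz_ineq2[of "grad \<phi> z" h] norm_w_ge(2)[OF w(1), of z] w(2)
        mult_right_mono[of "norm (grad \<phi> z)" 1 "norm h"] by simp
    thus "onorm (\<lambda>h. grad \<phi> z \<bullet> h) \<le> 1" by (intro onorm_le) simp
  qed auto
  thus ?thesis by simp
qed

text \<open>Bundled into one predicate so that such data can be chosen for all accuracies and radii
  at once. The bound no longer mentions any test function: the unit ball is replaced by the finitely
  many functions \<open>h p\<close> and the tail function \<open>h0\<close>.\<close>

definition pou_estimate :: "real \<Rightarrow> real \<Rightarrow> (real^'d \<Rightarrow> real) \<Rightarrow> (real^'d) set \<Rightarrow> (real^'d \<Rightarrow> real^'d \<Rightarrow> real) \<Rightarrow> bool" where
  "pou_estimate e R h0 I h \<longleftrightarrow> continuous_on UNIV h0 \<and>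
    (\<forall>x. 0 \<le> h0 x \<and> h0 x \<le> indicator (- cball 0 R) x) \<and> finite I \<and>
    (\<forall>p. continuous_on UNIV (h p)) \<and> (\<forall>p\<in>I. \<forall>x. 0 \<le> h p x \<and> h p x \<le> 1) \<and>
    (\<forall>\<mu>\<in>Mplus. \<forall>\<nu>\<in>Mplus. D2w \<mu> \<nu> \<le> e * (measure \<mu> (space \<mu>) + measure \<nu> (space \<nu>))
      + (\<integral>x. h0 x \<partial>\<mu>) + (\<integral>x. h0 x \<partial>\<nu>) + (\<Sum>p\<in>I. \<bar>(\<integral>x. h p x \<partial>\<mu>) - (\<integral>x. h p x \<partial>\<nu>)\<bar>))"

lemma pou_estimateD:
  assumes "pou_estimate e R h0 I h"
  shows "continuous_on UNIV h0" "0 \<le> h0 x \<and> h0 x \<le> indicator (- cball 0 R) x" "finite I"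
    "continuous_on UNIV (h p)" "p \<in> I \<Longrightarrow> 0 \<le> h p x \<and> h p x \<le> 1"
    "\<mu> \<in> Mplus \<Longrightarrow> \<nu> \<in> Mplus \<Longrightarrow> D2w \<mu> \<nu> \<le> e * (measure \<mu> (space \<mu>) + measure \<nu> (space \<nu>))
      + (\<integral>x. h0 x \<partial>\<mu>) + (\<integral>x. h0 x \<partial>\<nu>) + (\<Sum>p\<in>I. \<bar>(\<integral>x. h p x \<partial>\<mu>) - (\<integral>x. h p x \<partial>\<nu>)\<bar>)"
  using assms unfolding pou_estimate_def by blast+

text \<open>Bumps of radius \<open>e\<close> around a finite net of the ball, together with
  \<open>g0\<close>, have a positive sum everywhere; dividing by it gives a partition of unity.
  Replacing \<open>\<phi>\<close> by the sum of \<open>\<phi> p * h p\<close> costs \<open>e\<close>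
  by the Lipschitz bound, and \<open>h0\<close> outside since
  \<open>\<bar>\<phi>\<bar> \<le> 1\<close>. The values \<open>\<phi> p\<close>, again bounded by 1,
  then drop out.\<close>

lemma ex_pou_estimate:
  fixes R e :: real
  assumes e: "e > 0"
  shows "\<exists>(h0 :: real^'d \<Rightarrow> real) I h. pou_estimate e R h0 I h"
proof -
  obtain I where I: "finite I" "cball (0 :: real^'d) R \<subseteq> (\<Union>p\<in>I. ball p e)"
    using compact_cball[of "0::real^'d" R] e unfolding compact_eq_totally_bounded by blast
  define g where "g p x = max 0 (e - norm (x - p))" for p x :: "real^'d"
  \<comment> \<open>It vanishes on the ball, hence so does \<open>h0\<close>, and it is positive
    outside, where the bumps may all be 0.\<close>
  define g0 where "g0 x = max 0 (norm x - R)" for x :: "real^'d"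
  define s where "s x = g0 x + (\<Sum>p\<in>I. g p x)" for x
  have gn: "0 \<le> g p x" "0 \<le> g0 x" for p x by (auto simp: g_def g0_def)
  have gs: "0 \<le> (\<Sum>p\<in>I. g p x)" for x by (simp add: sum_nonneg gn)
  have s: "s x > 0" for x
  proof (cases "norm x \<le> R")
    case True
    then obtain p where "p \<in> I" "norm (p - x) < e" using I(2) by (auto simp: subset_iff dist_norm)
    hence "g p x > 0" by (simp add: g_def norm_minus_commute)
    hence "(\<Sum>p\<in>I. g p x) > 0" using I(1) \<open>p \<in> I\<close> gn by (intro sum_pos2) auto
    thus ?thesis using gn(2)[of x] by (simp add: s_def)
  next
    case False
    hence "g0 x > 0" by (simp add: g0_def)
    thus ?thesis using gs[of x] by (simp add: s_def)
  qed
  have c: "continuous_on UNIV (g p)" "continuous_on UNIV g0" "continuous_on UNIV s" for p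
    unfolding s_def g_def g0_def by (intro continuous_intros)+
  define h0 where "h0 x = g0 x / s x" for x
  define h where "h p x = g p x / s x" for p x
  have c0: "continuous_on UNIV h0" and ch: "continuous_on UNIV (h p)" for p
    unfolding h0_def h_def by (intro continuous_intros c ballI, simp add: less_imp_neq[OF s, symmetric])+
  have one: "h0 x + (\<Sum>p\<in>I. h p x) = 1" for x
    using s[of x] by (simp add: h0_def h_def sum_divide_distrib[symmetric] add_divide_distrib[symmetric] s_def)
  have h0n: "0 \<le> h0 x" and hn: "0 \<le> h p x" for p x
    using gn s[of x] by (simp_all add: h0_def h_def less_imp_le)
  have h01: "h0 x \<le> 1" for x using one[of x] sum_nonneg[of I "\<lambda>p. h p x"] hn by simp
  have h1: "h p x \<le> 1" if "p \<in> I" for p x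
    using one[of x] h0n[of x] member_le_sum[of p I "\<lambda>p. h p x"] hn I(1) that by simp
  have h0b: "h0 x \<le> indicator (- cball 0 R) x" for x
    using h01[of x] by (auto simp: indicator_def h0_def g0_def)
  have est: "D2w \<mu> \<nu> \<le> e * (measure \<mu> (space \<mu>) + measure \<nu> (space \<nu>))
      + (\<integral>x. h0 x \<partial>\<mu>) + (\<integral>x. h0 x \<partial>\<nu>) + (\<Sum>p\<in>I. \<bar>(\<integral>x. h p x \<partial>\<mu>) - (\<integral>x. h p x \<partial>\<nu>)\<bar>)"
    if M: "\<mu> \<in> Mplus" "\<nu> \<in> Mplus" for \<mu> \<nu>
  proof (rule D2w_least[OF M])
    fix \<phi> :: "real^'d \<Rightarrow> real" assume \<phi>: "\<phi> \<in> ball_w"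
    have pw: "\<bar>\<phi> x - (\<Sum>p\<in>I. \<phi> p * h p x)\<bar> \<le> e + h0 x" for x
    proof -
      have "\<phi> x = \<phi> x * (h0 x + (\<Sum>p\<in>I. h p x))" by (simp add: one)
      hence "\<phi> x - (\<Sum>p\<in>I. \<phi> p * h p x) = \<phi> x * h0 x + (\<Sum>p\<in>I. (\<phi> x - \<phi> p) * h p x)"
        by (simp add: distrib_left sum_distrib_left sum_subtractf left_diff_distrib)
      also have "\<bar>\<dots>\<bar> \<le> \<bar>\<phi> x * h0 x\<bar> + (\<Sum>p\<in>I. \<bar>(\<phi> x - \<phi> p) * h p x\<bar>)"
        by (rule order_trans[OF abs_triangle_ineq add_left_mono[OF sum_abs]])
      also have "\<dots> \<le> h0 x + (\<Sum>p\<in>I. e * h p x)"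
      proof (intro add_mono sum_mono)
        show "\<bar>\<phi> x * h0 x\<bar> \<le> h0 x"
          using ball_w_abs_le[OF \<phi>, of x] h0n[of x] mult_right_mono[of "\<bar>\<phi> x\<bar>" 1 "h0 x"]
          by (simp add: abs_mult)
        fix p
        show "\<bar>(\<phi> x - \<phi> p) * h p x\<bar> \<le> e * h p x"
        \<comment> \<open>Beyond distance \<open>e\<close> from its centre the bump is 0, so the
          Lipschitz bound is used only within that distance.\<close>
        proof (cases "norm (x - p) < e")
          case True
          thus ?thesis using ball_w_lipschitz[OF \<phi>, of x p] hn[of p x]
            by (auto simp: abs_mult intro!: mult_right_mono)
        qed (simp add: h_def g_def)
      qed
      also have "(\<Sum>p\<in>I. e * h p x) \<le> e"
        using one[of x] h0n[of x] e by (simp add: sum_distrib_left[symmetric])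
      finally show ?thesis by simp
    qed
    have app: "\<bar>(\<integral>x. \<phi> x \<partial>\<rho>) - (\<Sum>p\<in>I. \<phi> p * (\<integral>x. h p x \<partial>\<rho>))\<bar> \<le> e * measure \<rho> (space \<rho>) + (\<integral>x. h0 x \<partial>\<rho>)"
      if \<rho>: "\<rho> \<in> Mplus" for \<rho>
    proof -
      interpret finite_measure \<rho> using MplusD(1)[OF \<rho>] .
      have i[simp]: "integrable \<rho> \<phi>" "integrable \<rho> h0"
        using ball_w_integral_le(1)[OF \<phi> \<rho>] integrable_Mplus[OF \<rho> c0, of 1] h0n h01 by auto
      have ih[simp]: "integrable \<rho> (h p)" if "p \<in> I" for p
        using integrable_Mplus[OF \<rho> ch, of p 1] hn h1[OF that] by auto
      have "(\<integral>x. \<phi> x \<partial>\<rho>) - (\<Sum>p\<in>I. \<phi> p * (\<integral>x. h p x \<partial>\<rho>)) = (\<integral>x. \<phi> x - (\<Sum>p\<in>I. \<phi> p * h p x) \<partial>\<rho>)"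
        by simp
      also have "\<bar>\<dots>\<bar> \<le> (\<integral>x. \<bar>\<phi> x - (\<Sum>p\<in>I. \<phi> p * h p x)\<bar> \<partial>\<rho>)" by (rule integral_abs_bound)
      also have "\<dots> \<le> (\<integral>x. e + h0 x \<partial>\<rho>)" using pw by (intro integral_mono) auto
      finally show ?thesis by (simp add: mult.commute)
    qed
    have "\<bar>(\<Sum>p\<in>I. \<phi> p * (\<integral>x. h p x \<partial>\<mu>)) - (\<Sum>p\<in>I. \<phi> p * (\<integral>x. h p x \<partial>\<nu>))\<bar>
        = \<bar>\<Sum>p\<in>I. \<phi> p * ((\<integral>x. h p x \<partial>\<mu>) - (\<integral>x. h p x \<partial>\<nu>))\<bar>"
      by (simp add: sum_subtractf right_diff_distrib)
    also have "\<dots> \<le> (\<Sum>p\<in>I. \<bar>\<phi> p * ((\<integral>x. h p x \<partial>\<mu>) - (\<integral>x. h p x \<partial>\<nu>))\<bar>)" by (rule sum_abs)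
    also have "\<dots> \<le> (\<Sum>p\<in>I. \<bar>(\<integral>x. h p x \<partial>\<mu>) - (\<integral>x. h p x \<partial>\<nu>)\<bar>)"
      using ball_w_abs_le[OF \<phi>] by (intro sum_mono) (simp add: abs_mult mult_left_le_one_le)
    finally show "\<bar>(\<integral>x. \<phi> x \<partial>\<mu>) - (\<integral>x. \<phi> x \<partial>\<nu>)\<bar> \<le> e * (measure \<mu> (space \<mu>) + measure \<nu> (space \<nu>))
      + (\<integral>x. h0 x \<partial>\<mu>) + (\<integral>x. h0 x \<partial>\<nu>) + (\<Sum>p\<in>I. \<bar>(\<integral>x. h p x \<partial>\<mu>) - (\<integral>x. h p x \<partial>\<nu>)\<bar>)"
      using app[OF M(1)] app[OF M(2)] unfolding distrib_left by linarith
  qed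
  show ?thesis
    unfolding pou_estimate_def using c0 h0n h0b I(1) ch hn h1 est
    by (intro exI[of _ h0] exI[of _ I] exI[of _ h] conjI ballI allI)
qed

lemma Mplus_tail:
  fixes \<mu> :: "(real^'d) measure"
  assumes \<mu>: "\<mu> \<in> Mplus" and e: "e > 0"
  obtains n :: nat where "measure \<mu> (- cball 0 (real n)) < e"
proof -
  interpret finite_measure \<mu> using MplusD(1)[OF \<mu>] .
  have "(\<lambda>n. measure \<mu> (- cball 0 (real n))) \<longlonglongrightarrow> measure \<mu> (\<Inter>n. - cball 0 (real n))"
  proof (rule finite_Lim_measure_decseq)
    show "range (\<lambda>n. - cball (0::real^'d) (real n)) \<subseteq> sets \<mu>"
      unfolding MplusD(2)[OF \<mu>] by auto
    show "decseq (\<lambda>n. - cball (0::real^'d) (real n))" by (force simp: decseq_def)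
  qed
  moreover have "(\<Inter>n. - cball (0::real^'d) (real n)) = {}"
  proof -
    have "x \<notin> (\<Inter>n. - cball 0 (real n))" for x :: "real^'d"
    proof -
      obtain n :: nat where "norm x \<le> real n" using real_arch_simple by blast
      hence "x \<in> cball 0 (real n)" by simp
      thus ?thesis by blast
    qed
    thus ?thesis by blast
  qed
  ultimately have "(\<lambda>n. measure \<mu> (- cball 0 (real n))) \<longlonglongrightarrow> 0" by simp
  from order_tendstoD(2)[OF this e] show ?thesis
    using that by (auto simp: eventually_sequentially)
qed

lemma integral_le_measure:
  assumes "\<mu> \<in> Mplus" "continuous_on UNIV h" "A \<in> sets borel"
    and h: "\<And>x. 0 \<le> h x \<and> h x \<le> indicator A x"
  shows "(\<integral>x. h x \<partial>\<mu>) \<le> measure \<mu> A"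
proof -
  interpret finite_measure \<mu> using MplusD(1)[OF assms(1)] .
  have "\<bar>h x\<bar> \<le> 1" for x using h[of x] by (cases "x \<in> A") auto
  hence "integrable \<mu> h" by (rule integrable_Mplus[OF assms(1,2)])
  moreover have "integrable \<mu> (indicator A :: _ \<Rightarrow> real)"
    using assms(3) MplusD(2)[OF assms(1)] by (intro integrable_const_bound[of _ 1]) auto
  ultimately have "(\<integral>x. h x \<partial>\<mu>) \<le> (\<integral>x. indicator A x \<partial>\<mu>)"
    using h by (intro integral_mono) auto
  thus ?thesis using assms(3) MplusD(2)[OF assms(1)] by simp
qed

theorem narrow_conv_imp_D2w_tendsto:
  fixes \<mu> :: "(real^'d) measure"
  assumes \<nu>: "\<And>i. \<nu> i \<in> Mplus" and \<mu>: "\<mu> \<in> Mplus" and n: "narrow_conv \<nu> \<mu> F"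
  shows "((\<lambda>i. D2w (\<nu> i) \<mu>) \<longlongrightarrow> 0) F"
proof (rule tendstoI)
  fix e :: real assume e: "e > 0"
  let ?m = "\<lambda>\<mu>. measure \<mu> (space \<mu>)"
  \<comment> \<open>The limit of the bound is less than \<open>2 * d * m + 2 * d\<close>, where
    \<open>m\<close> is the mass of \<open>\<mu>\<close> and the last summand comes from the two
    tail integrals.\<close>
  define d where "d = e / (2 * ?m \<mu> + 4)"
  have pos: "2 * ?m \<mu> + 4 > 0" using measure_nonneg[of \<mu> "space \<mu>"] by linarith
  have d: "d > 0" using e pos by (simp add: d_def)
  obtain R :: nat where R: "measure \<mu> (- cball 0 (real R)) < d" using Mplus_tail[OF \<mu> d] .
  obtain h0 I h where pou: "pou_estimate d (real R) (h0 :: real^'d \<Rightarrow> real) I h"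
    using ex_pou_estimate[OF d] by blast
  note H = pou_estimateD(1-5)[OF pou] and est = pou_estimateD(6)[OF pou]
  have conv: "((\<lambda>i. \<integral>x. f x \<partial>\<nu> i) \<longlongrightarrow> (\<integral>x. f x \<partial>\<mu>)) F"
    if "continuous_on UNIV f" "\<And>x. 0 \<le> f x \<and> f x \<le> (1::real)" for f
  proof -
    have "bounded (range f)" using that(2) by (auto simp: bounded_iff intro!: exI[of _ 1])
    thus ?thesis using n that(1) by (auto simp: narrow_conv_def)
  qed
  have m: "((\<lambda>i. ?m (\<nu> i)) \<longlongrightarrow> ?m \<mu>) F"
    using conv[of "\<lambda>x. 1"] by (simp add: MplusD(1)[OF \<nu>] MplusD(1)[OF \<mu>])
  have "h0 x \<le> 1" for x using H(2)[of x] by (cases "x \<in> - cball 0 (real R)") auto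
  hence lim: "((\<lambda>i. d * (?m (\<nu> i) + ?m \<mu>) + (\<integral>x. h0 x \<partial>\<nu> i) + (\<integral>x. h0 x \<partial>\<mu>)
        + (\<Sum>p\<in>I. \<bar>(\<integral>x. h p x \<partial>\<nu> i) - (\<integral>x. h p x \<partial>\<mu>)\<bar>)) \<longlongrightarrow>
      d * (?m \<mu> + ?m \<mu>) + (\<integral>x. h0 x \<partial>\<mu>) + (\<integral>x. h0 x \<partial>\<mu>)
        + (\<Sum>p\<in>I. \<bar>(\<integral>x. h p x \<partial>\<mu>) - (\<integral>x. h p x \<partial>\<mu>)\<bar>)) F"
    using H by (intro tendsto_intros m conv) auto
  have "(\<integral>x. h0 x \<partial>\<mu>) < d"
    using integral_le_measure[OF \<mu> H(1) _ H(2)] R by force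
  moreover have "d * (?m \<mu> + ?m \<mu>) + d + d < e"
  proof -
    have "d * (?m \<mu> + ?m \<mu>) + d + d < (2 * ?m \<mu> + 4) * d" using d by (simp add: algebra_simps)
    also have "\<dots> = e" using pos by (simp add: d_def)
    finally show ?thesis .
  qed
  ultimately have "\<forall>\<^sub>F i in F. d * (?m (\<nu> i) + ?m \<mu>) + (\<integral>x. h0 x \<partial>\<nu> i) + (\<integral>x. h0 x \<partial>\<mu>)
        + (\<Sum>p\<in>I. \<bar>(\<integral>x. h p x \<partial>\<nu> i) - (\<integral>x. h p x \<partial>\<mu>)\<bar>) < e"
    by (intro order_tendstoD(2)[OF lim]) simp
  thus "\<forall>\<^sub>F i in F. dist (D2w (\<nu> i) \<mu>) 0 < e"
  proof eventually_elim
    case (elim i)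
    thus ?case using est[OF \<nu> \<mu>, of i] D2w_nonneg[of "\<nu> i" \<mu>] by (simp add: dist_real_def)
  qed
qed

text \<open>Sequences would leave open whether the two topologies agree; with an arbitrary filter
  the equivalence covers nets.\<close>

theorem limitin_D2w_iff_narrow_conv:
  fixes \<mu> :: "(real^'d) measure"
  assumes "\<And>i. \<nu> i \<in> Mplus" "\<mu> \<in> Mplus"
  shows "limitin (Metric_space.mtopology Mplus D2w) \<nu> \<mu> F \<longleftrightarrow> narrow_conv \<nu> \<mu> F"
proof -
  have "limitin (Metric_space.mtopology Mplus D2w) \<nu> \<mu> F \<longleftrightarrow> ((\<lambda>i. D2w (\<nu> i) \<mu>) \<longlongrightarrow> 0) F"
    using assms
    by (simp add: Metric_space.limitin_metric[OF Metric_space_Mplus] tendsto_iff dist_real_def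
        abs_of_nonneg[OF D2w_nonneg])
  thus ?thesis
    using D2w_tendsto_imp_narrow_conv[of \<nu> \<mu> F] narrow_conv_imp_D2w_tendsto[of \<nu> \<mu> F] assms by metis
qed

section \<open>Separability\<close>

text \<open>Separability is obtained from countable codes: points with equal codes are close, and one
  representative is selected for every code.\<close>

lemma countable_dense_by_codes:
  fixes d :: "'a \<Rightarrow> 'a \<Rightarrow> real" and K :: "nat \<Rightarrow> 'b set"
  assumes K: "\<And>n. countable (K n)"
    and code: "\<And>n a. a \<in> A \<Longrightarrow> \<exists>k \<in> K n. P n a k"
    and close: "\<And>n a b k. a \<in> A \<Longrightarrow> b \<in> A \<Longrightarrow> P n a k \<Longrightarrow> P n b k \<Longrightarrow> d a b \<le> 1 / real (Suc n)"
  shows "\<exists>S. countable S \<and> S \<subseteq> A \<and> (\<forall>a\<in>A. \<forall>e>0. \<exists>s\<in>S. d a s < e)"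
proof (intro exI conjI ballI allI impI)
  define S where "S = (\<lambda>(n, k). SOME a. a \<in> A \<and> P n a k) ` (SIGMA n:UNIV. {k \<in> K n. \<exists>a\<in>A. P n a k})"
  have ch: "(SOME a. a \<in> A \<and> P n a k) \<in> A \<and> P n (SOME a. a \<in> A \<and> P n a k) k" if "a \<in> A" "P n a k" for n k a
    using someI[of "\<lambda>a. a \<in> A \<and> P n a k" a] that by blast
  show "countable S"
    unfolding S_def by (intro countable_image countable_SIGMA) (auto intro: countable_subset[OF _ K])
  show "S \<subseteq> A" using ch by (auto simp: S_def)
  fix a and e :: real assume a: "a \<in> A" and "e > 0"
  then obtain n where n: "1 / real (Suc n) < e" using nat_approx_posE by blast
  obtain k where k: "k \<in> K n" "P n a k" using code[OF a] by blast
  let ?s = "SOME a. a \<in> A \<and> P n a k"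
  have "?s \<in> S" unfolding S_def using k a by force
  moreover have "d a ?s < e" using close[OF a _ k(2), of ?s] ch[OF a k(2)] n by linarith
  ultimately show "\<exists>s\<in>S. d a s < e" by blast
qed

section \<open>Countable dense sets of test functions\<close>

lemma list_approx_dense:
  fixes Q :: "'b::metric_space set"
  assumes "\<And>y e. e > 0 \<Longrightarrow> \<exists>q\<in>Q. dist y q < e" "e > 0"
  shows "\<exists>qs \<in> lists Q. list_all2 (\<lambda>p q. dist (f p) q < e) ps qs"
proof (induction ps)
  case (Cons p ps)
  then obtain qs where "qs \<in> lists Q" "list_all2 (\<lambda>p q. dist (f p) q < e) ps qs" by blast
  moreover obtain q where "q \<in> Q" "dist (f p) q < e" using assms by blast
  ultimately show ?case by (intro bexI[of _ "q # qs"]) auto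
qed auto

lemma list_all2_approx_close:
  assumes "list_all2 (\<lambda>p q. dist (f p) q < e) ps qs" "list_all2 (\<lambda>p q. dist (g p) q < e) ps qs"
    "p \<in> set ps"
  shows "dist (f p) (g p) < 2 * e"
proof -
  obtain i where i: "i < length ps" "p = ps ! i" using assms(3) by (auto simp: in_set_conv_nth)
  have "dist (f p) (qs ! i) < e" "dist (g p) (qs ! i) < e"
    using assms(1,2) i by (auto simp: list_all2_conv_all_nth)
  thus ?thesis using dist_triangle2[of "f p" "g p" "qs ! i"] by linarith
qed

lemma countable_approximating_set:
  "\<exists>Q :: 'b::{metric_space, second_countable_topology} set. countable Q \<and> (\<forall>y. \<forall>e>0. \<exists>q\<in>Q. dist y q < e)"
proof -
  obtain Q :: "'b set" where Q: "countable Q" "\<And>X. open X \<Longrightarrow> X \<noteq> {} \<Longrightarrow> \<exists>d\<in>Q. d \<in> X"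
    using countable_dense_setE by blast
  have "\<exists>q\<in>Q. dist y q < e" if "e > 0" for y :: 'b and e :: real
    using that Q(2)[of "ball y e"] by (auto simp: ball_eq_empty not_le)
  thus ?thesis using Q(1) by blast
qed

text \<open>A code records a radius \<open>N\<close> of the support, a mesh index \<open>m\<close>
  fine enough for uniform continuity, and approximate values in \<open>Q\<close> on a finite net of
  the ball of radius \<open>N\<close>. Compact support makes every function uniformly continuous, so
  each has a code of every accuracy.\<close>

lemma separable_compactly_supported:
  fixes A :: "('a::euclidean_space \<Rightarrow> 'b::{real_normed_vector, second_countable_topology}) set"
  assumes c: "\<And>f. f \<in> A \<Longrightarrow> continuous_on UNIV f"
    and v: "\<And>f. f \<in> A \<Longrightarrow> \<exists>N. \<forall>x. norm x > N \<longrightarrow> f x = 0"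
  obtains S where "countable S" "S \<subseteq> A"
    "\<And>f e. f \<in> A \<Longrightarrow> e > 0 \<Longrightarrow> \<exists>g\<in>S. \<forall>x. dist (f x) (g x) \<le> e"
proof -
  obtain Q :: "'b set" where Q: "countable Q" "\<And>y e. e > 0 \<Longrightarrow> \<exists>q\<in>Q. dist y q < e"
    using countable_approximating_set by blast
  have "\<exists>ps. cball (0::'a) (real N) \<subseteq> (\<Union>p\<in>set ps. ball p (1 / real (Suc m)))" for N m
  proof -
    obtain P where "finite P" "cball (0::'a) (real N) \<subseteq> (\<Union>p\<in>P. ball p (1 / real (Suc m)))"
      using compact_cball[of "0::'a" "real N"] unfolding compact_eq_totally_bounded
      by (metis of_nat_0_less_iff zero_less_Suc zero_less_divide_1_iff)
    thus ?thesis using finite_list by blast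
  qed
  then obtain ps where ps: "\<And>N m. cball (0::'a) (real N) \<subseteq> (\<Union>p\<in>set (ps N m). ball p (1 / real (Suc m)))"
    by metis
  \<comment> \<open>The tolerance is a quarter of the target: going from \<open>f x\<close> over
    \<open>f p\<close> and \<open>g p\<close> to \<open>g x\<close> costs one, two and one
    tolerances.\<close>
  define P where "P n f k = (case k of (N, m, qs) \<Rightarrow>
      (\<forall>x. norm x > real N \<longrightarrow> f x = 0) \<and>
      (\<forall>x y. dist x y < 1 / real (Suc m) \<longrightarrow> dist (f x) (f y) < 1 / (4 * real (Suc n))) \<and>
      list_all2 (\<lambda>p q. dist (f p) q < 1 / (4 * real (Suc n))) (ps N m) qs)"
    for n and f :: "'a \<Rightarrow> 'b" and k
  define d where "d f g = (SUP x. dist (f x) (g x))" for f g :: "'a \<Rightarrow> 'b"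
  have close: "dist (f x) (g x) \<le> 1 / real (Suc n)" if "P n f k" "P n g k" for n f g k x
  proof -
    obtain N m qs where k: "k = (N, m, qs)" by (cases k) auto
    show ?thesis
    proof (cases "norm x > real N")
      case False
      then obtain p where p: "p \<in> set (ps N m)" "dist p x < 1 / real (Suc m)"
        using ps[of N m] by (force simp: subset_iff)
      define e where "e = 1 / (4 * real (Suc n))"
      have "dist (f p) (f x) < e" "dist (g p) (g x) < e" "dist (f p) (g p) < 2 * e"
        using that p list_all2_approx_close[of f e "ps N m" qs g p] unfolding P_def k e_def by auto
      hence "dist (f x) (g x) < 4 * e"
        using dist_triangle[of "f x" "g x" "f p"] dist_triangle[of "f p" "g x" "g p"]
        by (simp add: dist_commute)
      moreover have "4 * e = 1 / real (Suc n)" unfolding e_def by (simp del: of_nat_Suc)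
      ultimately show ?thesis by linarith
    qed (use that in \<open>auto simp: P_def k\<close>)
  qed
  have code: "\<exists>k \<in> (UNIV :: nat set) \<times> (UNIV :: nat set) \<times> lists Q. P n f k" if fA: "f \<in> A" for n f
  proof -
    obtain N0 where N0: "\<And>x. norm x > N0 \<Longrightarrow> f x = 0" using v[OF fA] by blast
    obtain N :: nat where "N0 \<le> real N" using real_arch_simple by blast
    hence N: "\<And>x. norm x > real N \<Longrightarrow> f x = 0" using N0 by force
    let ?e = "1 / (4 * real (Suc n))"
    \<comment> \<open>The radius is enlarged by 1 because two points at distance less than 1 either
      both lie in this larger ball or both lie beyond radius \<open>N\<close>, where
      \<open>f\<close> is 0.\<close>
    have "uniformly_continuous_on (cball 0 (real N + 1)) f"
      by (intro compact_uniformly_continuous continuous_on_subset[OF c[OF fA]]) auto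
    then obtain \<delta> where \<delta>: "\<delta> > 0"
      "\<And>x y. x \<in> cball 0 (real N + 1) \<Longrightarrow> y \<in> cball 0 (real N + 1) \<Longrightarrow> dist x y < \<delta> \<Longrightarrow> dist (f x) (f y) < ?e"
      unfolding uniformly_continuous_on_def by (metis divide_pos_pos mult_pos_pos of_nat_0_less_iff zero_less_Suc zero_less_numeral zero_less_one)
    obtain m where m: "1 / real (Suc m) < \<delta>" using nat_approx_posE[OF \<delta>(1)] by blast
    have "dist (f x) (f y) < ?e" if "dist x y < 1 / real (Suc m)" for x y
    proof (cases "norm x \<le> real N + 1 \<and> norm y \<le> real N + 1")
      case True
      thus ?thesis using that m \<delta>(2)[of x y] by simp
    next
      case False
      have "dist x y < 1" using that by (rule order_less_le_trans) simp
      hence "\<bar>norm x - norm y\<bar> < 1"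
        using norm_triangle_ineq3[of x y] by (simp add: dist_norm)
      hence "norm x > real N" "norm y > real N" using False by auto
      thus ?thesis using N by simp
    qed
    moreover obtain qs where "qs \<in> lists Q" "list_all2 (\<lambda>p q. dist (f p) q < ?e) (ps N m) qs"
      using list_approx_dense[OF Q(2), of ?e f "ps N m"] by auto
    ultimately show ?thesis using N by (intro bexI[of _ "(N, m, qs)"]) (auto simp: P_def)
  qed
  have K: "countable ((UNIV :: nat set) \<times> (UNIV :: nat set) \<times> lists Q)"
    using Q(1) by (intro countable_SIGMA countable_lists) auto
  have bdd: "bdd_above (range (\<lambda>x. dist (f x) (g x)))" if fg: "f \<in> A" "g \<in> A" for f g
  proof -
    obtain N M where "\<And>x. norm x > N \<Longrightarrow> f x = 0" "\<And>x. norm x > M \<Longrightarrow> g x = 0"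
      using v[OF fg(1)] v[OF fg(2)] by blast
    hence "bounded (range (\<lambda>x. dist (f x) (g x)))"
      by (intro bounded_range_if_vanishes_outside[of _ "max N M"] continuous_intros c fg) auto
    thus ?thesis by (rule bounded_imp_bdd_above)
  qed
  have "\<exists>S. countable S \<and> S \<subseteq> A \<and> (\<forall>f\<in>A. \<forall>e>0. \<exists>g\<in>S. d f g < e)"
  proof (rule countable_dense_by_codes[where K = "\<lambda>_. (UNIV :: nat set) \<times> (UNIV :: nat set) \<times> lists Q"
      and P = P and A = A and d = d])
    show "d f g \<le> 1 / real (Suc n)" if "P n f k" "P n g k" for n f g k
      unfolding d_def using close[OF that] by (intro cSUP_least) auto
  qed (use K code in auto)
  then obtain S where S: "countable S" "S \<subseteq> A" "\<And>f e. f \<in> A \<Longrightarrow> e > 0 \<Longrightarrow> \<exists>g\<in>S. d f g < e"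
    by blast
  show ?thesis
  proof (rule that[OF S(1,2)])
    fix f e assume f: "f \<in> A" and "e > (0::real)"
    then obtain g where g: "g \<in> S" "d f g < e" using S(3) by blast
    hence "dist (f x) (g x) \<le> e" for x
      using cSUP_upper[OF _ bdd[OF f], of x g] S(2) unfolding d_def by force
    thus "\<exists>g\<in>S. \<forall>x. dist (f x) (g x) \<le> e" using g(1) by blast
  qed
qed

text \<open>The 2-jet with the weights built in: uniform closeness of jets is closeness in
  \<open>norm_w\<close> up to a factor 3. Jets of \<open>C2c\<close> functions are continuous,
  compactly supported and take values in a second countable space, as
  \<open>separable_compactly_supported\<close> asks.\<close>

definition jet :: "(real^'d \<Rightarrow> real) \<Rightarrow> real^'d \<Rightarrow> real \<times> (real^'d) \<times> (real^'d^'d)" where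
  "jet f x = (f x, (1 + norm x) *\<^sub>R grad f x, (1 + (norm x)\<^sup>2) *\<^sub>R hess f x)"

lemma norm_w_diff_le_jet:
  assumes "f \<in> C2" "g \<in> C2" and d: "\<And>x. dist (jet f x) (jet g x) \<le> e"
  shows "norm_w (\<lambda>x. f x - g x) \<le> 3 * e"
proof -
  have 1: "dist (f x) (g x) \<le> e"
    "dist ((1 + norm x) *\<^sub>R grad f x) ((1 + norm x) *\<^sub>R grad g x) \<le> e"
    "dist ((1 + (norm x)\<^sup>2) *\<^sub>R hess f x) ((1 + (norm x)\<^sup>2) *\<^sub>R hess g x) \<le> e" for x
    using d[of x] dist_fst_le[of "jet f x" "jet g x"] dist_snd_le[of "jet f x" "jet g x"]
      dist_fst_le[of "snd (jet f x)" "snd (jet g x)"] dist_snd_le[of "snd (jet f x)" "snd (jet g x)"]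
    by (simp_all add: jet_def)
  have "norm_w (\<lambda>x. f x - g x) \<le> e + e + e"
  proof (rule C2wI(2)[OF C2_diff[OF assms(1,2)]])
    fix x
    show "\<bar>f x - g x\<bar> \<le> e" using 1(1)[of x] by (simp add: dist_real_def)
    show "(1 + norm x) * norm (grad (\<lambda>x. f x - g x) x) \<le> e"
      using 1(2)[of x]
      by (simp add: grad_diff[OF assms(1,2)] dist_norm scaleR_diff_right[symmetric] del: scaleR_diff_right)
    show "(1 + (norm x)\<^sup>2) * norm (hess (\<lambda>x. f x - g x) x) \<le> e"
      using 1(3)[of x]
      by (simp add: hess_diff[OF assms(1,2)] dist_norm scaleR_diff_right[symmetric] del: scaleR_diff_right)
  qed
  thus ?thesis by simp
qed

lemma C2c_ball_separable:
  obtains S :: "(real^'d \<Rightarrow> real) set" where "countable S" "S \<subseteq> C2c \<inter> ball_w"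
    "\<And>f e. f \<in> C2c \<inter> ball_w \<Longrightarrow> e > 0 \<Longrightarrow> \<exists>g\<in>S. norm_w (\<lambda>x. f x - g x) < e"
proof -
  let ?A = "C2c \<inter> ball_w :: (real^'d \<Rightarrow> real) set"
  obtain T where T: "countable T" "T \<subseteq> jet ` ?A"
    "\<And>F e. F \<in> jet ` ?A \<Longrightarrow> e > 0 \<Longrightarrow> \<exists>G\<in>T. \<forall>x. dist (F x) (G x) \<le> e"
  proof (rule separable_compactly_supported[of "jet ` ?A"])
    fix F assume "F \<in> jet ` ?A"
    then obtain f where "f \<in> C2c" and F: "F = jet f" by blast
    then obtain N where f: "f \<in> C2" "\<And>x. norm x > N \<Longrightarrow> f x = 0" unfolding C2c_iff by blast
    show "continuous_on UNIV F"
      unfolding F jet_def by (intro continuous_intros C2D f)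
    show "\<exists>N. \<forall>x. norm x > N \<longrightarrow> F x = 0"
      using f(2) C2_vanish_derivatives[OF f] by (intro exI[of _ N]) (auto simp: F jet_def zero_prod_def)
  qed blast
  \<comment> \<open>The dense jets are jets of members of \<open>?A\<close> itself, so they lift to
    a countable subset of the ball.\<close>
  obtain S where S: "countable S" "S \<subseteq> ?A" "T = jet ` S"
    using countable_subset_image[of T jet ?A] T(1,2) by blast
  show ?thesis
  proof (rule that[OF S(1,2)])
    fix f :: "real^'d \<Rightarrow> real" and e :: real assume f: "f \<in> ?A" and e: "e > 0"
    then obtain g where g: "g \<in> S" "\<And>x. dist (jet f x) (jet g x) \<le> e / 6"
      using T(3)[of "jet f" "e / 6"] unfolding S(3) by auto
    have "f \<in> C2" "g \<in> C2" using f g S(2) by (auto simp: C2c_iff)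
    from norm_w_diff_le_jet[OF this g(2)] show "\<exists>g\<in>S. norm_w (\<lambda>x. f x - g x) < e"
      using g(1) e by (intro bexI[of _ g]) auto
  qed
qed

text \<open>An approximant from \<open>C2c\<close> may have norm slightly above 1. Dividing it by
  \<open>c = max 1 (norm_w g)\<close> moves it by at most \<open>c - 1\<close>, and this excess is
  itself below the approximation error.\<close>

lemma C2c_dense_in_ball_w:
  assumes f: "f \<in> ball_w" and e: "e > 0"
  shows "\<exists>g\<in>C2c \<inter> ball_w. norm_w (\<lambda>x. f x - g x) < e"
proof -
  have fw: "f \<in> C2w" "norm_w f \<le> 1" "f \<in> C20w" using f ball_w_C2w by (auto simp: ball_w_def)
  obtain g where g: "g \<in> C2c" "norm_w (\<lambda>x. f x - g x) < e / 2"
    using fw(3) e unfolding C20w_def closure_w_def by (auto dest!: spec[of _ "e / 2"])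
  have gw: "g \<in> C2w" using g C2c_subset_C2w by blast
  define c where "c = max 1 (norm_w g)"
  have c: "c \<ge> 1" "norm_w g \<le> c" by (auto simp: c_def)
  have "c - 1 < e / 2"
    using norm_w_le_add_diff[OF gw fw(1)] norm_w_diff_commute[OF fw(1) gw] g(2) fw(2) e by (auto simp: c_def)
  let ?h = "\<lambda>x. inverse c * g x"
  have hw: "?h \<in> C2w" by (rule C2w_cmult[OF gw])
  have "norm_w ?h \<le> \<bar>inverse c\<bar> * norm_w g" by (rule norm_w_cmult_le[OF gw])
  also have "\<dots> \<le> 1" using c by (simp add: field_simps)
  finally have h: "?h \<in> C2c \<inter> ball_w"
    using C2c_cmult[OF g(1)] C2c_subset_C20w by (auto simp: ball_w_def)
  have "norm_w (\<lambda>x. (1 - inverse c) * g x) \<le> \<bar>1 - inverse c\<bar> * norm_w g" by (rule norm_w_cmult_le[OF gw])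
  also have "\<dots> \<le> (1 - inverse c) * c"
    using c by (intro mult_mono) (auto simp: inverse_le_1_iff norm_w_nonneg[OF gw])
  also have "\<dots> = c - 1" using c by (simp add: algebra_simps)
  finally have "norm_w (\<lambda>x. g x - ?h x) \<le> c - 1" by (simp add: left_diff_distrib)
  hence "norm_w (\<lambda>x. f x - ?h x) < e"
    using norm_w_diff_triangle[OF fw(1) gw hw] g(2) \<open>c - 1 < e / 2\<close> by linarith
  thus ?thesis by (rule bexI[OF _ h])
qed

theorem countable_dense_C2c:
  obtains S :: "(real^'d \<Rightarrow> real) set"
  where "countable S" "S \<subseteq> C2c" "S \<subseteq> ball_w" "closure_w S = ball_w"
    "\<And>\<mu> \<nu>. \<mu> \<in> Mplus \<Longrightarrow> \<nu> \<in> Mplus \<Longrightarrow>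
      D2w \<mu> \<nu> = (SUP \<phi>\<in>S. \<bar>(\<integral>x. \<phi> x \<partial>\<mu>) - (\<integral>x. \<phi> x \<partial>\<nu>)\<bar>)"
proof -
  obtain S :: "(real^'d \<Rightarrow> real) set" where S: "countable S" "S \<subseteq> C2c \<inter> ball_w"
    "\<And>f e. f \<in> C2c \<inter> ball_w \<Longrightarrow> e > 0 \<Longrightarrow> \<exists>g\<in>S. norm_w (\<lambda>x. f x - g x) < e"
    by (rule C2c_ball_separable) (rule that)
  have Sw: "g \<in> C2w" "norm_w g \<le> 1" "g \<in> C2c" "g \<in> ball_w" if "g \<in> S" for g
    using that S(2) ball_w_C2w by (auto simp: ball_w_def)
  have dense: "\<exists>g\<in>S. norm_w (\<lambda>x. f x - g x) < e" if f: "f \<in> ball_w" and e: "e > 0" for f e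
  proof -
    obtain h where h: "h \<in> C2c \<inter> ball_w" "norm_w (\<lambda>x. f x - h x) < e / 2"
      using C2c_dense_in_ball_w[OF f, of "e / 2"] e by auto
    obtain g where g: "g \<in> S" "norm_w (\<lambda>x. h x - g x) < e / 2" using S(3)[OF h(1), of "e / 2"] e by auto
    have "norm_w (\<lambda>x. f x - g x) \<le> norm_w (\<lambda>x. f x - h x) + norm_w (\<lambda>x. h x - g x)"
      using f h g Sw ball_w_C2w by (intro norm_w_diff_triangle) auto
    thus ?thesis using h g by (intro bexI[of _ g]) auto
  qed
  have cl: "closure_w S = ball_w"
  proof
    show "ball_w \<subseteq> closure_w S" using dense ball_w_C2w by (auto simp: closure_w_def)
    show "closure_w S \<subseteq> ball_w"
    proof
      fix f assume f: "f \<in> closure_w S"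
      hence fw: "f \<in> C2w" and app: "\<And>e. e > 0 \<Longrightarrow> \<exists>g\<in>S. norm_w (\<lambda>x. f x - g x) < e"
        by (auto simp: closure_w_def)
      have "f \<in> C20w" using f Sw(3) by (fastforce simp: C20w_def closure_w_def)
      moreover have "norm_w f \<le> 1"
      proof (rule field_le_epsilon)
        fix e :: real assume "e > 0"
        then obtain g where "g \<in> S" "norm_w (\<lambda>x. f x - g x) < e" using app by blast
        thus "norm_w f \<le> 1 + e"
          using norm_w_le_add_diff[OF fw, of g] Sw(1,2)[of g] by linarith
      qed
      ultimately show "f \<in> ball_w" by (simp add: ball_w_def)
    qed
  qed
  obtain z where z: "z \<in> S" using dense ball_w_nonempty zero_less_one by blast
  have D: "D2w \<mu> \<nu> = (SUP \<phi>\<in>S. \<bar>(\<integral>x. \<phi> x \<partial>\<mu>) - (\<integral>x. \<phi> x \<partial>\<nu>)\<bar>)"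
    if M: "\<mu> \<in> Mplus" "\<nu> \<in> Mplus" for \<mu> \<nu> :: "(real^'d) measure"
  proof (rule antisym)
    let ?d = "\<lambda>\<phi>. \<bar>(\<integral>x. \<phi> x \<partial>\<mu>) - (\<integral>x. \<phi> x \<partial>\<nu>)\<bar>"
    show "(SUP \<phi>\<in>S. ?d \<phi>) \<le> D2w \<mu> \<nu>"
      using z by (intro cSUP_least D2w_upper[OF M] Sw) auto
    have bdd: "bdd_above (?d ` S)"
      using bdd_above_D2w[OF M] S(2) by (meson bdd_above_mono image_mono le_inf_iff)
    show "D2w \<mu> \<nu> \<le> (SUP \<phi>\<in>S. ?d \<phi>)"
    proof (rule D2w_least[OF M])
      fix \<phi> :: "real^'d \<Rightarrow> real" assume \<phi>: "\<phi> \<in> ball_w"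
      let ?m = "measure \<mu> (space \<mu>) + measure \<nu> (space \<nu>)"
      have m: "?m \<ge> 0" by simp
      show "?d \<phi> \<le> (SUP \<phi>\<in>S. ?d \<phi>)"
      proof (rule field_le_epsilon)
        fix e :: real assume e: "e > 0"
        \<comment> \<open>Closeness \<open>c\<close> in norm is uniform closeness, which costs
          \<open>c\<close> times the total mass of both measures in the difference of integrals; the
          summand 1 keeps the divisor positive.\<close>
        define c where "c = e / (?m + 1)"
        have m1: "?m + 1 > 0" using m by linarith
        have c1: "c > 0" unfolding c_def using e m1 by (rule divide_pos_pos)
        have "c * ?m \<le> c * (?m + 1)" using c1 by (intro mult_left_mono) auto
        also have "\<dots> = e" unfolding c_def times_divide_eq_left using nonzero_mult_div_cancel_right[of "?m + 1" e] m1 by linarith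
        finally have c: "c > 0" "c * ?m \<le> e" using c1 by auto
        obtain g where g: "g \<in> S" "norm_w (\<lambda>x. \<phi> x - g x) < c" using dense[OF \<phi> c(1)] by blast
        have w: "(\<lambda>x. \<phi> x - g x) \<in> C2w" using \<phi> g Sw ball_w_C2w C2w_diff by blast
        have a: "\<bar>\<phi> x - g x\<bar> \<le> c" for x using norm_w_ge(1)[OF w, of x] g(2) by simp
        have "\<bar>(\<integral>x. \<phi> x \<partial>\<rho>) - (\<integral>x. g x \<partial>\<rho>)\<bar> \<le> c * measure \<rho> (space \<rho>)" if "\<rho> \<in> Mplus" for \<rho>
          using that \<phi> g(1) Sw ball_w_C2w
          by (intro integral_diff_le a integrable_C2w MplusD) auto
        from this[OF M(1)] this[OF M(2)] have "?d \<phi> \<le> ?d g + c * ?m" unfolding distrib_left by linarith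
        also have "?d g \<le> (SUP \<phi>\<in>S. ?d \<phi>)" using g(1) bdd by (rule cSUP_upper)
        finally show "?d \<phi> \<le> (SUP \<phi>\<in>S. ?d \<phi>) + e" using c(2) by linarith
      qed
    qed
  qed
  show ?thesis using that[OF S(1) _ _ cl D] S(2) by blast
qed

text \<open>A probability measure is coded by a radius with small tail and by approximate integrals
  of the finitely many functions of \<open>pou_estimate\<close>, which then bounds the distance of
  two measures with equal codes. Mass 1 makes its first term uniform.\<close>

theorem separable_space_Prob:
  "separable_space (Metric_space.mtopology (Prob :: (real^'d) measure set) D2w)"
proof -
  interpret Metric_space "Prob :: (real^'d) measure set" D2w by (rule Metric_space_Prob)
  have "\<exists>(h0 :: real^'d \<Rightarrow> real) I h. pou_estimate (1 / (8 * real (Suc n))) (real R) h0 (set I) h" for n R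
  proof -
    have e: "1 / (8 * real (Suc n)) > 0" by simp
    obtain h0 I h where pou: "pou_estimate (1 / (8 * real (Suc n))) (real R) (h0 :: real^'d \<Rightarrow> real) I h"
      using ex_pou_estimate[OF e] by blast
    obtain l where "set l = I" using finite_list[OF pou_estimateD(3)[OF pou]] by blast
    thus ?thesis using pou by blast
  qed
  then obtain h0 I h
    where pou: "\<And>n R. pou_estimate (1 / (8 * real (Suc n))) (real R) (h0 n R :: real^'d \<Rightarrow> real) (set (I n R)) (h n R)"
    by metis
  obtain Q :: "real set" where Q: "countable Q" "\<And>y e. e > 0 \<Longrightarrow> \<exists>q\<in>Q. dist y q < e"
    using countable_approximating_set by blast
  \<comment> \<open>Each integral may differ by \<open>2 * tol\<close>; dividing by the number of
    functions keeps the sum of these errors bounded, and \<open>Suc\<close> avoids division by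
    0.\<close>
  define tol where "tol n R = 1 / (8 * real (Suc n) * real (Suc (card (set (I n R)))))" for n R
  have tol: "tol n R > 0" "2 * tol n R * real (card (set (I n R))) \<le> 2 / (8 * real (Suc n))" for n R
  proof -
    show "tol n R > 0" by (simp add: tol_def)
    have "real (card (set (I n R))) / real (Suc (card (set (I n R)))) \<le> 1" by simp
    hence "2 / (8 * real (Suc n)) * (real (card (set (I n R))) / real (Suc (card (set (I n R))))) \<le> 2 / (8 * real (Suc n)) * 1"
      by (intro mult_left_mono) auto
    thus "2 * tol n R * real (card (set (I n R))) \<le> 2 / (8 * real (Suc n))" by (simp add: tol_def)
  qed
  define P where "P n \<mu> k = (case k of (R, qs) \<Rightarrow> measure \<mu> (- cball 0 (real R)) < 1 / (8 * real (Suc n)) \<and>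
      list_all2 (\<lambda>p q. dist (\<integral>x. h n R p x \<partial>\<mu>) q < tol n R) (I n R) qs)"
    for n k and \<mu> :: "(real^'d) measure"
  have "\<exists>S. countable S \<and> S \<subseteq> Prob \<and> (\<forall>\<mu>\<in>(Prob :: (real^'d) measure set). \<forall>e>0. \<exists>\<nu>\<in>S. D2w \<mu> \<nu> < e)"
  proof (rule countable_dense_by_codes[where K = "\<lambda>_. (UNIV :: nat set) \<times> lists Q"
      and P = P and A = "Prob :: (real^'d) measure set" and d = D2w])
    show "countable ((UNIV :: nat set) \<times> lists Q)" for n :: nat
      using Q(1) by (intro countable_SIGMA countable_lists) auto
    fix n and \<mu> :: "(real^'d) measure" assume "\<mu> \<in> Prob"
    hence \<mu>: "\<mu> \<in> Mplus" "measure \<mu> (space \<mu>) = 1" by (auto simp: Prob_def prob_space.prob_space)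
    obtain R :: nat where R: "measure \<mu> (- cball 0 (real R)) < 1 / (8 * real (Suc n))"
      using Mplus_tail[OF \<mu>(1), of "1 / (8 * real (Suc n))"] by auto
    obtain qs where "qs \<in> lists Q" "list_all2 (\<lambda>p q. dist (\<integral>x. h n R p x \<partial>\<mu>) q < tol n R) (I n R) qs"
      using list_approx_dense[OF Q(2) tol(1), of "\<lambda>p. \<integral>x. h n R p x \<partial>\<mu>"] by blast
    thus "\<exists>k\<in>UNIV \<times> lists Q. P n \<mu> k"
      using R by (intro bexI[of _ "(R, qs)"]) (auto simp: P_def)
    fix \<nu> :: "(real^'d) measure" and k assume "\<nu> \<in> Prob" and P: "P n \<mu> k" "P n \<nu> k"
    hence \<nu>: "\<nu> \<in> Mplus" "measure \<nu> (space \<nu>) = 1" by (auto simp: Prob_def prob_space.prob_space)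
    obtain R qs where k: "k = (R, qs)" by (cases k) auto
    define e where "e = 1 / (8 * real (Suc n))"
    note G = pou_estimateD[OF pou[of n R, folded e_def]]
    have t: "(\<integral>x. h0 n R x \<partial>\<rho>) \<le> e" if "\<rho> \<in> Mplus" "P n \<rho> k" for \<rho>
      using integral_le_measure[OF that(1), of "h0 n R" "- cball 0 (real R)"] G(1,2) that(2)
      by (force simp: P_def k e_def)
    have "(\<Sum>p\<in>set (I n R). \<bar>(\<integral>x. h n R p x \<partial>\<mu>) - (\<integral>x. h n R p x \<partial>\<nu>)\<bar>)
        \<le> (\<Sum>p\<in>set (I n R). 2 * tol n R)"
    proof (rule sum_mono)
      fix p assume "p \<in> set (I n R)"
      from list_all2_approx_close[OF _ _ this, of "\<lambda>p. \<integral>x. h n R p x \<partial>\<mu>" "tol n R" qs "\<lambda>p. \<integral>x. h n R p x \<partial>\<nu>"]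
      show "\<bar>(\<integral>x. h n R p x \<partial>\<mu>) - (\<integral>x. h n R p x \<partial>\<nu>)\<bar> \<le> 2 * tol n R"
        using P by (simp add: P_def k dist_real_def)
    qed
    also have "\<dots> \<le> 2 * e" using tol(2)[of n R] by (simp add: e_def mult_ac)
    finally have s: "(\<Sum>p\<in>set (I n R). \<bar>(\<integral>x. h n R p x \<partial>\<mu>) - (\<integral>x. h n R p x \<partial>\<nu>)\<bar>) \<le> 2 * e" .
    \<comment> \<open>Of the budget \<open>8 * e = 1 / Suc n\<close>, the masses, the two tails and
      the sum take \<open>2 * e\<close> each.\<close>
    have "D2w \<mu> \<nu> \<le> e * (1 + 1) + (\<integral>x. h0 n R x \<partial>\<mu>) + (\<integral>x. h0 n R x \<partial>\<nu>) +
        (\<Sum>p\<in>set (I n R). \<bar>(\<integral>x. h n R p x \<partial>\<mu>) - (\<integral>x. h n R p x \<partial>\<nu>)\<bar>)"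
      using G(6)[OF \<mu>(1) \<nu>(1)] \<mu>(2) \<nu>(2) by simp
    also have "\<dots> \<le> 6 * e" using t[OF \<mu>(1) P(1)] t[OF \<nu>(1) P(2)] s by simp
    also have "\<dots> \<le> 1 / real (Suc n)" by (simp add: e_def field_simps)
    finally show "D2w \<mu> \<nu> \<le> 1 / real (Suc n)" .
  qed
  then obtain S where S: "countable S" "S \<subseteq> Prob" "\<And>\<mu> e. \<mu> \<in> (Prob :: (real^'d) measure set) \<Longrightarrow> e > 0 \<Longrightarrow> \<exists>\<nu>\<in>S. D2w \<mu> \<nu> < e"
    by blast
  show ?thesis
    unfolding separable_space_def
  proof (intro exI conjI)
    show "countable S" by fact
    show "S \<subseteq> topspace mtopology" using S(2) by simp
    show "mtopology closure_of S = topspace mtopology"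
    proof -
      have "\<exists>\<nu>\<in>S. \<nu> \<in> mball \<mu> e" if "\<mu> \<in> Prob" "e > 0" for \<mu> e
        using S(2) S(3)[OF that] that(1) unfolding in_mball by blast
      thus ?thesis unfolding metric_closure_of topspace_mtopology by blast
    qed
  qed
qed

section \<open>Prokhorov's theorem\<close>

text \<open>Doubling the remainder and removing a digit keeps it in the unit interval, so after
  \<open>n\<close> digits the error is at most \<open>(1 / 2) ^ n\<close>. The endpoint 1 is
  included: its remainder stays 1 and all digits are set.\<close>

lemma binary_expansion:
  fixes y :: real
  assumes "0 \<le> y" "y \<le> 1"
  shows "\<exists>b. (\<lambda>k. of_bool (b k) * (1 / 2) ^ Suc k) sums y"
proof -
  define r where "r = rec_nat y (\<lambda>_ x. 2 * x - of_bool (x \<ge> 1 / 2))"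
  define b where "b k \<longleftrightarrow> r k \<ge> 1 / 2" for k
  have r: "r 0 = y" "r (Suc k) = 2 * r k - of_bool (b k)" for k by (simp_all add: r_def b_def)
  have inv: "0 \<le> r k \<and> r k \<le> 1" for k
    by (induction k) (use assms in \<open>auto simp: r b_def\<close>)
  have part: "(\<Sum>k<n. of_bool (b k) * (1 / 2) ^ Suc k) = y - r n * (1 / 2) ^ n" for n
    by (induction n) (auto simp: r field_simps)
  have "(\<lambda>n. (1 / 2 :: real) ^ n) \<longlonglongrightarrow> 0" by (rule LIMSEQ_power_zero) simp
  moreover have "norm (r n * (1 / 2) ^ n) \<le> (1 / 2) ^ n" for n
    using inv[of n] by (simp add: abs_mult mult_left_le_one_le)
  ultimately have "(\<lambda>n. r n * (1 / 2) ^ n) \<longlonglongrightarrow> 0"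
    by (intro Lim_null_comparison[of "\<lambda>n. r n * (1 / 2) ^ n" "\<lambda>n. (1 / 2) ^ n"] always_eventually) auto
  from tendsto_diff[OF tendsto_const[of y] this]
  have "(\<lambda>k. of_bool (b k) * (1 / 2) ^ Suc k) sums y"
    unfolding sums_def part by simp
  thus ?thesis by blast
qed

section \<open>Schoenberg's space-filling curve and a Borel section\<close>

lemma cos_add_2npi: "cos (2 * real n * pi + x) = cos x"
  by (simp add: cos_add)

text \<open>A continuous function of period 2 that is 0 on \<open>[0, 1/3]\<close> and 1 on
  \<open>[2/3, 1]\<close>: it reads the leading ternary digit of a point of the Cantor set. The
  truncated cosine supplies continuity and periodicity at once.\<close>

definition digit :: "real \<Rightarrow> real" where
  "digit t = max 0 (min 1 (1 / 2 - cos (pi * t)))"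

lemma digit_bounds: "0 \<le> digit t" "digit t \<le> 1"
  by (auto simp: digit_def)

lemma digit_add_even: "digit (2 * real n + t) = digit t"
  using cos_add_2npi[of n "pi * t"] by (simp add: digit_def algebra_simps)

lemma digit_eq_0:
  assumes "0 \<le> t" "t \<le> 1 / 3"
  shows "digit t = 0"
proof -
  have "cos (pi / 3) \<le> cos (pi * t)"
    using assms by (intro cos_monotone_0_pi_le) auto
  thus ?thesis by (simp add: digit_def cos_60)
qed

lemma digit_eq_1:
  assumes "2 / 3 \<le> t" "t \<le> 1"
  shows "digit t = 1"
proof -
  have "cos (pi / 3) \<le> cos (pi * (1 - t))"
    using assms by (intro cos_monotone_0_pi_le) (auto simp: field_simps)
  also have "cos (pi * (1 - t)) = - cos (pi * t)" by (simp add: right_diff_distrib)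
  finally show ?thesis by (simp add: digit_def cos_60)
qed

text \<open>The point with ternary digits \<open>2 * b k\<close> in the Cantor set carries the whole sequence \<open>b\<close>.\<close>

lemma ex_digits:
  fixes b :: "nat \<Rightarrow> bool"
  shows "\<exists>t. 0 \<le> t \<and> t \<le> 1 \<and> (\<forall>m. digit (3 ^ m * t) = of_bool (b m))"
proof -
  define T where "T m = (\<Sum>j. 2 * of_bool (b (j + m)) * (1 / 3 :: real) ^ Suc j)" for m
  have g: "(\<lambda>j. 2 * (1 / 3 :: real) ^ Suc j) sums 1"
    using sums_mult[OF geometric_sums[of "1 / 3 :: real"], of "2 / 3"] by simp
  have s: "summable (\<lambda>j. 2 * of_bool (b (j + m)) * (1 / 3 :: real) ^ Suc j)" for m
    by (rule summable_comparison_test'[OF sums_summable[OF g], of 0]) auto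
  have T01: "0 \<le> T m" "T m \<le> 1" for m
  proof -
    show "0 \<le> T m" unfolding T_def by (intro suminf_nonneg s) auto
    have "T m \<le> (\<Sum>j. 2 * (1 / 3 :: real) ^ Suc j)"
      unfolding T_def by (intro suminf_le s sums_summable[OF g]) auto
    thus "T m \<le> 1" using sums_unique[OF g] by simp
  qed
  \<comment> \<open>Shifting the expansion by one place. With \<open>T (Suc m)\<close> in the unit
    interval this also puts \<open>T m\<close> into the third of the interval selected by
    \<open>b m\<close>.\<close>
  have rec: "3 * T m = 2 * of_bool (b m) + T (Suc m)" for m
  proof -
    have "T m = 2 * of_bool (b m) / 3 + (\<Sum>j. 2 * of_bool (b (Suc j + m)) * (1 / 3 :: real) ^ Suc (Suc j))"
      using suminf_split_head[OF s[of m]] by (simp add: T_def)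
    also have "(\<lambda>j. 2 * of_bool (b (Suc j + m)) * (1 / 3 :: real) ^ Suc (Suc j))
        = (\<lambda>j. 1 / 3 * (2 * of_bool (b (j + Suc m)) * (1 / 3) ^ Suc j))"
      by (auto simp: fun_eq_iff)
    also have "suminf \<dots> = 1 / 3 * T (Suc m)" unfolding T_def by (rule suminf_mult[OF s])
    finally show ?thesis by simp
  qed
  \<comment> \<open>The ternary digits are 0 or 2, so what is shifted out is an even integer, which
    \<open>digit\<close> does not see.\<close>
  have "\<exists>N::nat. 3 ^ m * T 0 = 2 * real N + T m" for m
  proof (induction m)
    case 0
    show ?case by (intro exI[of _ 0]) simp
  next
    case (Suc m)
    then obtain N :: nat where "3 ^ m * T 0 = 2 * real N + T m" by blast
    hence "3 ^ Suc m * T 0 = 2 * real (3 * N) + 3 * T m" by simp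
    also have "\<dots> = 2 * real (3 * N + of_bool (b m)) + T (Suc m)" by (simp add: rec)
    finally show ?case by blast
  qed
  hence "digit (3 ^ m * T 0) = digit (T m)" for m using digit_add_even by metis
  moreover have "digit (T m) = of_bool (b m)" for m
    using rec[of m] T01[of "Suc m"] T01[of m]
    by (cases "b m") (auto intro!: digit_eq_0 digit_eq_1)
  ultimately show ?thesis using T01 by (intro exI[of _ "T 0"]) auto
qed

text \<open>Schoenberg's space-filling curve: every coordinate reads off its own infinite set of ternary
  digits.  The factor \<open>level\<close> has the constant value \<open>N\<close> on \<open>[2N, 2N + 1]\<close>, which spreads the curve
  over the whole space.\<close>

definition level :: "real \<Rightarrow> real" where
  "level t = t / 2 - arccos (cos (pi * t)) / (2 * pi)"

lemma level_eq:
  assumes "0 \<le> u" "u \<le> 1"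
  shows "level (2 * real N + u) = real N"
proof -
  have "cos (pi * (2 * real N + u)) = cos (pi * u)"
    using cos_add_2npi[of N "pi * u"] by (simp add: algebra_simps)
  moreover have "arccos (cos (pi * u)) = pi * u"
    using assms by (intro arccos_cos) auto
  ultimately show ?thesis by (simp add: level_def field_simps)
qed

lemma ex_space_filling_curve:
  "\<exists>f :: real \<Rightarrow> real^'d. continuous_on UNIV f \<and> (\<forall>x. \<exists>t. 0 \<le> t \<and> t \<le> 2 * norm x + 3 \<and> f t = x)"
proof -
  \<comment> \<open>Distinct coordinates receive disjoint infinite sets of digit positions, so their
    binary expansions can be prescribed independently by one point.\<close>
  define e where "e i k = prod_encode (to_nat_on (UNIV :: 'd set) i, k)" for i k
  have e: "e i k = e j l \<longleftrightarrow> i = j \<and> k = l" for i j :: 'd and k l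
    by (simp add: e_def countable_finite)
  define c where "c i t = (\<Sum>k. (1 / 2 :: real) ^ Suc k * digit (3 ^ e i k * t))" for i :: 'd and t
  have geo: "summable (\<lambda>k. (1 / 2 :: real) ^ Suc k)"
    using summable_mult[OF summable_geometric[of "1 / 2 :: real"], of "1 / 2"] by simp
  have cc: "continuous_on UNIV (c i)" for i
  proof (rule uniform_limit_theorem)
    show "uniform_limit UNIV (\<lambda>n t. \<Sum>k<n. (1 / 2 :: real) ^ Suc k * digit (3 ^ e i k * t)) (c i) sequentially"
      unfolding c_def
      by (rule Weierstrass_m_test[OF _ geo]) (use digit_bounds in \<open>auto simp: abs_mult\<close>)
    show "\<forall>\<^sub>F n in sequentially. continuous_on UNIV (\<lambda>t. \<Sum>k<n. (1 / 2 :: real) ^ Suc k * digit (3 ^ e i k * t))"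
      unfolding digit_def by (intro always_eventually allI continuous_intros)
  qed simp
  have cper: "c i (2 * real N + t) = c i t" for i N t
  proof -
    have "digit (3 ^ m * (2 * real N + t)) = digit (3 ^ m * t)" for m
      using digit_add_even[of "3 ^ m * N" "3 ^ m * t"] by (simp add: algebra_simps)
    thus ?thesis by (simp add: c_def)
  qed
  have csurj: "\<exists>u. 0 \<le> u \<and> u \<le> 1 \<and> (\<forall>i. c i u = y i)" if y: "\<And>i. 0 \<le> y i \<and> y i \<le> 1" for y
  proof -
    have "\<forall>i. \<exists>b. (\<lambda>k. of_bool (b k) * (1 / 2) ^ Suc k) sums y i"
      using binary_expansion y by blast
    then obtain b where b: "\<And>i. (\<lambda>k. of_bool (b i k) * (1 / 2) ^ Suc k) sums y i" by metis
    define B where "B m \<longleftrightarrow> (\<exists>i k. m = e i k \<and> b i k)" for m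
    obtain u where u: "0 \<le> u" "u \<le> 1" "\<And>m. digit (3 ^ m * u) = of_bool (B m)"
      using ex_digits by blast
    have "B (e i k) = b i k" for i k using e by (auto simp: B_def)
    hence "c i u = (\<Sum>k. of_bool (b i k) * (1 / 2) ^ Suc k)" for i
      unfolding c_def u(3) by (simp only: mult.commute)
    hence "c i u = y i" for i using sums_unique[OF b[of i]] by simp
    thus ?thesis using u by blast
  qed
  define f where "f t = level t *\<^sub>R (\<chi> i. 2 * c i t - 1)" for t
  have "continuous_on UNIV f"
    unfolding f_def level_def by (intro continuous_intros cc) auto
  moreover have "\<exists>t. 0 \<le> t \<and> t \<le> 2 * norm x + 3 \<and> f t = x" for x
  proof -
    \<comment> \<open>Some cube \<open>[-N, N]^d\<close> contains \<open>x\<close>, and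
      \<open>N\<close> is positive even for \<open>x = 0\<close>, so \<open>x / N\<close> is
      defined. As \<open>N \<le> norm x + 1\<close>, the time \<open>2 * N + u\<close> is at most
      \<open>2 * norm x + 3\<close>.\<close>
    define N where "N = Suc (nat \<lfloor>norm x\<rfloor>)"
    have N: "norm x \<le> real N" "real N \<le> norm x + 1" "real N > 0"
      unfolding N_def using norm_ge_zero[of x] by linarith+
    have "0 \<le> (x $ i / real N + 1) / 2 \<and> (x $ i / real N + 1) / 2 \<le> 1" for i
      using component_le_norm_cart[of x i] N by (auto simp: field_simps abs_le_iff)
    from csurj[of "\<lambda>i. (x $ i / real N + 1) / 2", OF this] obtain u where u: "0 \<le> u" "u \<le> 1" "\<And>i. c i u = (x $ i / real N + 1) / 2" by blast
    have "2 * c i u - 1 = x $ i / real N" for i using u(3)[of i] by simp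
    hence "f (2 * real N + u) = x"
      using N(3) u(1,2) by (simp add: f_def level_eq cper vec_eq_iff)
    thus ?thesis using u N by (intro exI[of _ "2 * real N + u"]) auto
  qed
  ultimately show ?thesis by blast
qed

text \<open>Let \<open>s x\<close> be the first nonnegative time at which the curve visits
  \<open>x\<close>. Its sublevel sets are images of compact intervals, hence closed, so
  \<open>s\<close> is lower semicontinuous. The bound on \<open>s\<close> is what transports
  tightness.\<close>

lemma ex_curve_with_borel_section:
  "\<exists>(f :: real \<Rightarrow> real^'d) s. continuous_on UNIV f \<and> s \<in> borel_measurable borel \<and>
     (\<forall>x. f (s x) = x \<and> 0 \<le> s x \<and> s x \<le> 2 * norm x + 3)"
proof -
  obtain f :: "real \<Rightarrow> real^'d" where f: "continuous_on UNIV f"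
    and surj: "\<And>x. \<exists>t. 0 \<le> t \<and> t \<le> 2 * norm x + 3 \<and> f t = x"
    using ex_space_filling_curve by blast
  define Z where "Z x = {t. 0 \<le> t \<and> f t = x}" for x
  define s where "s x = Inf (Z x)" for x
  have bdd: "bdd_below (Z x)" for x unfolding Z_def by (rule bdd_belowI[of _ 0]) auto
  have cl: "closed (Z x)" for x
    unfolding Z_def by (intro closed_Collect_conj closed_Collect_le closed_Collect_eq continuous_intros f)
  have ne: "Z x \<noteq> {}" for x using surj[of x] by (auto simp: Z_def)
  have sZ: "s x \<in> Z x" for x unfolding s_def by (rule closed_contains_Inf[OF ne bdd cl])
  have le: "s x \<le> t" if "t \<in> Z x" for x t unfolding s_def using that bdd by (rule cInf_lower)
  have "{x. s x \<le> a} = f ` {0..a}" for a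
    using sZ le by (force simp: Z_def)
  moreover have "closed (f ` {0..a})" for a
    by (intro compact_imp_closed compact_continuous_image continuous_on_subset[OF f]) auto
  ultimately have "s \<in> borel_measurable borel"
    by (simp add: borel_measurable_iff_le borel_closed)
  moreover have "s x \<le> 2 * norm x + 3" for x
    using surj[of x] le[of _ x] by (force simp: Z_def)
  ultimately show ?thesis using f sZ by (intro exI[of _ f] exI[of _ s]) (auto simp: Z_def)
qed

text \<open>Prokhorov's theorem is reduced to Helly's theorem on the line: push the measures forward along
  the section and the limit back along the continuous curve.\<close>

theorem tight_imp_narrow_convergent_subseq:
  fixes \<rho> :: "nat \<Rightarrow> (real^'d) measure"
  assumes \<rho>: "\<And>n. prob_space (\<rho> n)" "\<And>n. sets (\<rho> n) = sets borel"
    and tight: "\<And>e::real. e > 0 \<Longrightarrow> \<exists>R. \<forall>n. measure (\<rho> n) (- cball 0 R) < e"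
  obtains r \<mu> where "strict_mono (r :: nat \<Rightarrow> nat)" "\<mu> \<in> Prob" "narrow_conv (\<rho> \<circ> r) \<mu> sequentially"
proof -
  obtain f :: "real \<Rightarrow> real^'d" and s where f: "continuous_on UNIV f" and s: "s \<in> borel_measurable borel"
    and fs: "\<And>x. f (s x) = x" "\<And>x. 0 \<le> s x" "\<And>x. s x \<le> 2 * norm x + 3"
    using ex_curve_with_borel_section by blast
  have f_m: "f \<in> borel_measurable borel" by (rule borel_measurable_continuous_onI[OF f])
  have s_m: "s \<in> borel_measurable (\<rho> n)" for n
    using s \<rho>(2) measurable_cong_sets by blast
  have sp: "space (\<rho> n) = UNIV" for n using sets_eq_imp_space_eq[OF \<rho>(2)] by simp
  define \<sigma> where "\<sigma> n = distr (\<rho> n) borel s" for n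
  have rd: "real_distribution (\<sigma> n)" for n
    unfolding \<sigma>_def using prob_space.real_distribution_distr[OF \<rho>(1) s_m] .
  have "tight \<sigma>"
    unfolding tight_def
  proof (intro conjI allI impI)
    fix e :: real assume "e > 0"
    then obtain R where R: "\<And>n. measure (\<rho> n) (- cball 0 R) < e" using tight by blast
    show "\<exists>a b. a < b \<and> (\<forall>n. measure (\<sigma> n) {a<..b} > 1 - e)"
    proof (intro exI conjI allI)
      \<comment> \<open>The interval is open on the left and must contain the value 0 of
        \<open>s\<close>, hence the endpoint -1. The absolute value allows for a negative
        \<open>R\<close>.\<close>
      show "-1 < 2 * \<bar>R\<bar> + 3" by simp
      fix n
      interpret prob_space "\<rho> n" by (rule \<rho>(1))
      have "1 - e < measure (\<rho> n) (cball 0 R)"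
        using R[of n] prob_compl[of "cball 0 R"] by (simp add: sp \<rho>(2) Compl_eq_Diff_UNIV)
      also have "\<dots> \<le> measure (\<rho> n) (s -` {-1<..2 * \<bar>R\<bar> + 3} \<inter> space (\<rho> n))"
      proof (rule finite_measure_mono)
        show "cball 0 R \<subseteq> s -` {-1<..2 * \<bar>R\<bar> + 3} \<inter> space (\<rho> n)"
        proof
          fix x :: "real^'d" assume "x \<in> cball 0 R"
          hence "norm x \<le> R" by simp
          thus "x \<in> s -` {-1<..2 * \<bar>R\<bar> + 3} \<inter> space (\<rho> n)"
            using fs(2)[of x] fs(3)[of x] by (auto simp: sp)
        qed
        show "s -` {-1<..2 * \<bar>R\<bar> + 3} \<inter> space (\<rho> n) \<in> sets (\<rho> n)"
          using s_m by (rule measurable_sets) simp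
      qed
      also have "\<dots> = measure (\<sigma> n) {-1<..2 * \<bar>R\<bar> + 3}"
        unfolding \<sigma>_def using s_m by (simp add: measure_distr)
      finally show "1 - e < measure (\<sigma> n) {-1<..2 * \<bar>R\<bar> + 3}" .
    qed
  qed (rule rd)
  from tight_imp_convergent_subsubsequence[OF this strict_mono_id]
  obtain r M where r: "strict_mono r" and M: "real_distribution M" "weak_conv_m (\<sigma> \<circ> id \<circ> r) M"
    by blast
  interpret M: real_distribution M by (rule M(1))
  have f_M: "f \<in> borel_measurable M" using f_m M.events_eq_borel measurable_cong_sets by blast
  define \<mu> where "\<mu> = distr M borel f"
  have "prob_space \<mu>" unfolding \<mu>_def by (rule M.prob_space_distr[OF f_M])
  hence "\<mu> \<in> Prob"
    by (auto simp: Prob_def Mplus_def \<mu>_def prob_space_def)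
  moreover have "narrow_conv (\<rho> \<circ> r) \<mu> sequentially"
    unfolding narrow_conv_def
  proof (intro allI impI, elim conjE)
    fix h :: "real^'d \<Rightarrow> real" assume h: "continuous_on UNIV h" and "bounded (range h)"
    then obtain B where B: "\<And>x. norm (h x) \<le> B" by (auto simp: bounded_iff)
    have hm: "h \<in> borel_measurable borel" by (rule borel_measurable_continuous_onI[OF h])
    have hf: "continuous_on UNIV (\<lambda>t. h (f t))"
      by (rule continuous_on_compose2[OF h f]) auto
    have "(\<lambda>n. \<integral>t. h (f t) \<partial>(\<sigma> \<circ> id \<circ> r) n) \<longlonglongrightarrow> (\<integral>t. h (f t) \<partial>M)"
      by (rule weak_conv_imp_integral_bdd_continuous_conv[OF _ M])
        (use rd hf B in \<open>auto simp: continuous_on_eq_continuous_at\<close>)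
    \<comment> \<open>Since \<open>f (s x) = x\<close>, pushing forward along \<open>s\<close> and
      composing with \<open>f\<close> gives back the original integral.\<close>
    moreover have "(\<integral>t. h (f t) \<partial>(\<sigma> \<circ> id \<circ> r) n) = (\<integral>x. h x \<partial>(\<rho> \<circ> r) n)" for n
      using integral_distr[OF s_m[of "r n"], of "\<lambda>t. h (f t)"] borel_measurable_continuous_onI[OF hf]
      by (simp add: \<sigma>_def fs(1))
    moreover have "(\<integral>t. h (f t) \<partial>M) = (\<integral>x. h x \<partial>\<mu>)"
      unfolding \<mu>_def using integral_distr[OF f_M hm] by simp
    ultimately show "(\<lambda>n. \<integral>x. h x \<partial>(\<rho> \<circ> r) n) \<longlonglongrightarrow> (\<integral>x. h x \<partial>\<mu>)" by simp
  qed
  ultimately show ?thesis using that[OF r] by blast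
qed

section \<open>From probability measures to finite measures\<close>

lemma
  fixes \<mu> :: "(real^'d) measure"
  assumes \<mu>: "\<mu> \<in> Mplus" and c: "c \<ge> (0::real)"
  defines "\<nu> \<equiv> density \<mu> (\<lambda>_. ennreal c)"
  shows const_density_Mplus: "\<nu> \<in> Mplus"
    and measure_const_density: "A \<in> sets borel \<Longrightarrow> measure \<nu> A = c * measure \<mu> A"
    and integral_const_density: "h \<in> borel_measurable borel \<Longrightarrow> (\<integral>x. h x \<partial>\<nu>) = c * (\<integral>x. h x \<partial>\<mu> :: real)"
proof -
  interpret finite_measure \<mu> using MplusD(1)[OF \<mu>] .
  have s: "sets \<mu> = sets borel" "space \<mu> = UNIV" using MplusD[OF \<mu>] by auto
  have em: "emeasure \<nu> A = ennreal c * emeasure \<mu> A" if "A \<in> sets borel" for A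
    using that by (simp add: \<nu>_def emeasure_density_const s)
  show "measure \<nu> A = c * measure \<mu> A" if "A \<in> sets borel" for A
    using em[OF that] c by (simp add: measure_def enn2real_mult)
  have "emeasure \<nu> UNIV \<noteq> \<infinity>"
    using em[of UNIV] emeasure_finite[of UNIV] by (simp add: ennreal_mult_eq_top_iff)
  thus "\<nu> \<in> Mplus"
    by (auto simp: Mplus_def \<nu>_def s intro!: finite_measureI)
  show "(\<integral>x. h x \<partial>\<nu>) = c * (\<integral>x. h x \<partial>\<mu>)" if "h \<in> borel_measurable borel" for h :: "real^'d \<Rightarrow> real"
  proof -
    have "h \<in> borel_measurable \<mu>" using that s(1) measurable_cong_sets by blast
    thus ?thesis using c unfolding \<nu>_def by (subst integral_density) auto
  qed
qed

theorem tight_Mplus_imp_narrow_convergent_subseq: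
  fixes \<mu> :: "nat \<Rightarrow> (real^'d) measure"
  assumes \<mu>: "\<And>n. \<mu> n \<in> Mplus" and m: "(\<lambda>n. measure (\<mu> n) (space (\<mu> n))) \<longlonglongrightarrow> m"
    and tight: "\<And>e::real. e > 0 \<Longrightarrow> \<exists>R. \<forall>n. measure (\<mu> n) (- cball 0 R) < e"
  obtains r \<nu> where "strict_mono (r :: nat \<Rightarrow> nat)" "\<nu> \<in> Mplus" "narrow_conv (\<mu> \<circ> r) \<nu> sequentially"
proof -
  let ?m = "\<lambda>n. measure (\<mu> n) (space (\<mu> n))"
  have "m \<ge> 0" by (rule LIMSEQ_le_const[OF m]) auto
  then consider "m = 0" | "m > 0" by linarith
  thus ?thesis
  proof cases
    case 1
    let ?\<nu> = "null_measure borel :: (real^'d) measure"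
    have "narrow_conv (\<mu> \<circ> id) ?\<nu> sequentially"
      unfolding narrow_conv_def
    proof (intro allI impI, elim conjE)
      fix h :: "real^'d \<Rightarrow> real" assume h: "continuous_on UNIV h" and "bounded (range h)"
      then obtain B where B: "\<And>x. \<bar>h x\<bar> \<le> B" by (auto simp: bounded_iff)
      have "\<bar>(\<integral>x. h x \<partial>\<mu> n) - (\<integral>x. 0 \<partial>\<mu> n)\<bar> \<le> B * ?m n" for n
        by (rule integral_diff_le[OF MplusD(1)[OF \<mu>] integrable_Mplus[OF \<mu> h B]]) (use B in auto)
      moreover have "(\<lambda>n. B * ?m n) \<longlonglongrightarrow> 0" using tendsto_mult_left[OF m, of B] 1 by simp
      ultimately have "(\<lambda>n. \<integral>x. h x \<partial>\<mu> n) \<longlonglongrightarrow> 0"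
        by (intro Lim_null_comparison[of "\<lambda>n. \<integral>x. h x \<partial>\<mu> n" "\<lambda>n. B * ?m n"] always_eventually) auto
      thus "(\<lambda>n. \<integral>x. h x \<partial>(\<mu> \<circ> id) n) \<longlonglongrightarrow> (\<integral>x. h x \<partial>?\<nu>)" by simp
    qed
    moreover have "?\<nu> \<in> Mplus" by (auto simp: Mplus_def intro!: finite_measureI)
    ultimately show ?thesis using that strict_mono_id by blast
  next
    case 2
    have "\<forall>\<^sub>F n in sequentially. m / 2 < ?m n" using 2 by (intro order_tendstoD(1)[OF m]) simp
    \<comment> \<open>Early masses may be 0 and are discarded. The lower bound \<open>m / 2\<close>
      keeps the normalized family tight: a tail below \<open>e * (m / 2)\<close> becomes one below
      \<open>e\<close>.\<close>
    then obtain N where N: "\<And>n. n \<ge> N \<Longrightarrow> m / 2 < ?m n" by (auto simp: eventually_sequentially)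
    define M where "M n = ?m (n + N)" for n
    have M: "M n > m / 2" "M n > 0" for n using N[of "n + N"] 2 by (auto simp: M_def)
    define \<rho> where "\<rho> n = density (\<mu> (n + N)) (\<lambda>_. ennreal (inverse (M n)))" for n
    have iM: "inverse (M n) \<ge> 0" for n using M(2)[of n] by simp
    have \<rho>: "\<rho> n \<in> Mplus" for n
      unfolding \<rho>_def by (rule const_density_Mplus[OF \<mu> iM])
    have \<rho>m: "measure (\<rho> n) A = inverse (M n) * measure (\<mu> (n + N)) A" if "A \<in> sets borel" for n A
      unfolding \<rho>_def by (rule measure_const_density[OF \<mu> iM that])
    have ps: "prob_space (\<rho> n)" for n
    proof -
      have "measure (\<rho> n) (space (\<rho> n)) = 1"
        using \<rho>m[of UNIV n] M(2)[of n] by (simp add: MplusD(3)[OF \<rho>] M_def MplusD(3)[OF \<mu>])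
      thus ?thesis using MplusD(1)[OF \<rho>]
        by (intro prob_spaceI) (simp add: finite_measure.emeasure_eq_measure)
    qed
    have t: "\<exists>R. \<forall>n. measure (\<rho> n) (- cball 0 R) < e" if "e > 0" for e :: real
    proof -
      obtain R where R: "\<And>n. measure (\<mu> n) (- cball 0 R) < e * (m / 2)"
        using tight[OF mult_pos_pos[OF \<open>e > 0\<close>, of "m / 2"]] 2 by auto
      have "measure (\<rho> n) (- cball 0 R) < e" for n
      proof -
        have "measure (\<mu> (n + N)) (- cball 0 R) < e * M n"
          using R[of "n + N"] mult_strict_left_mono[OF M(1)[of n] that] by linarith
        thus ?thesis using M(2)[of n] \<rho>m[of "- cball 0 R" n]
          by (simp add: pos_divide_less_eq divide_inverse_commute[symmetric])
      qed
      thus ?thesis by blast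
    qed
    obtain r \<nu> where r: "strict_mono (r :: nat \<Rightarrow> nat)" and \<nu>: "\<nu> \<in> Prob" "narrow_conv (\<rho> \<circ> r) \<nu> sequentially"
      using tight_imp_narrow_convergent_subseq[OF ps MplusD(2)[OF \<rho>] t] by blast
    have \<nu>M: "\<nu> \<in> Mplus" using \<nu>(1) Prob_subset_Mplus by blast
    let ?\<nu> = "density \<nu> (\<lambda>_. ennreal m)"
    have sm: "strict_mono (\<lambda>n. r n + N)" using r by (simp add: strict_mono_def)
    have "narrow_conv (\<mu> \<circ> (\<lambda>n. r n + N)) ?\<nu> sequentially"
      unfolding narrow_conv_def
    proof (intro allI impI, elim conjE)
      fix h :: "real^'d \<Rightarrow> real" assume h: "continuous_on UNIV h" and b: "bounded (range h)"
      have hm: "h \<in> borel_measurable borel" by (rule borel_measurable_continuous_onI[OF h])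
      have "(\<lambda>n. \<integral>x. h x \<partial>\<rho> (r n)) \<longlonglongrightarrow> (\<integral>x. h x \<partial>\<nu>)"
        using \<nu>(2) h b by (simp add: narrow_conv_def)
      moreover have "(\<lambda>n. M (r n)) \<longlonglongrightarrow> m"
        using LIMSEQ_subseq_LIMSEQ[OF m sm] by (simp add: M_def o_def)
      ultimately have "(\<lambda>n. M (r n) * (\<integral>x. h x \<partial>\<rho> (r n))) \<longlonglongrightarrow> m * (\<integral>x. h x \<partial>\<nu>)"
        by (intro tendsto_mult)
      moreover have "M n * (\<integral>x. h x \<partial>\<rho> n) = (\<integral>x. h x \<partial>\<mu> (n + N))" for n
        using integral_const_density[OF \<mu> iM hm] M(2)[of n] by (simp add: \<rho>_def)
      ultimately show "(\<lambda>n. \<integral>x. h x \<partial>(\<mu> \<circ> (\<lambda>n. r n + N)) n) \<longlonglongrightarrow> (\<integral>x. h x \<partial>?\<nu>)"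
        using integral_const_density[OF \<nu>M \<open>m \<ge> 0\<close> hm] by simp
    qed
    thus ?thesis using that[OF sm const_density_Mplus[OF \<nu>M \<open>m \<ge> 0\<close>]] by blast
  qed
qed

section \<open>Completeness\<close>

lemma measure_tail_le_cutoff:
  fixes \<mu> :: "(real^'d) measure"
  assumes \<mu>: "\<mu> \<in> Mplus" and R: "R \<ge> 1"
  shows "measure \<mu> (- cball 0 R) \<le> measure \<mu> (space \<mu>) - (\<integral>x. cutoff R x \<partial>\<mu>)"
proof -
  interpret finite_measure \<mu> using MplusD(1)[OF \<mu>] .
  have A: "- cball (0::real^'d) R \<in> sets \<mu>" by (simp add: MplusD(2)[OF \<mu>])
  have i: "integrable \<mu> (indicator (- cball 0 R) :: _ \<Rightarrow> real)"
    using A by (intro integrable_const_bound[of _ 1]) auto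
  note c = integrable_cutoff[OF \<mu> R]
  have "indicator (- cball 0 R) x \<le> 1 - cutoff R x" for x :: "real^'d"
    using cutoff_le_1[of R x] cutoff_eq_0[OF R, of x] by (cases "norm x \<le> R") auto
  hence "(\<integral>x. indicator (- cball 0 R) x \<partial>\<mu>) \<le> (\<integral>x. 1 - cutoff R x \<partial>\<mu>)"
    using i c by (intro integral_mono) auto
  thus ?thesis using A c by simp
qed

theorem mcomplete_Mplus: "Metric_space.mcomplete (Mplus :: (real^'d) measure set) D2w"
proof -
  interpret Metric_space "Mplus :: (real^'d) measure set" D2w by (rule Metric_space_Mplus)
  show ?thesis
    unfolding mcomplete_def
  proof (intro allI impI)
    fix \<mu> :: "nat \<Rightarrow> (real^'d) measure" assume cau: "MCauchy \<mu>"
    hence \<mu>: "\<mu> n \<in> Mplus" for n by (auto simp: MCauchy_def)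
    let ?C = "cutoff_const TYPE('d)"
    let ?m = "\<lambda>n. measure (\<mu> n) (space (\<mu> n))"
    have C: "?C > 0" by (rule cutoff_const_pos)
    have small: "\<exists>N. \<forall>n\<ge>N. \<forall>k\<ge>N. ?C * D2w (\<mu> n) (\<mu> k) < e" if e: "e > 0" for e
    proof -
      obtain N where "\<And>n k. n \<ge> N \<Longrightarrow> k \<ge> N \<Longrightarrow> D2w (\<mu> n) (\<mu> k) < e / ?C"
        using cau divide_pos_pos[OF e C] unfolding MCauchy_def by meson
      thus ?thesis using C by (intro exI[of _ N]) (auto simp: pos_less_divide_eq mult.commute)
    qed
    have "Cauchy ?m"
    proof (rule metric_CauchyI)
      fix e :: real assume "e > 0"
      from small[OF this] obtain N where "\<forall>n\<ge>N. \<forall>k\<ge>N. ?C * D2w (\<mu> n) (\<mu> k) < e" by blast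
      thus "\<exists>N. \<forall>n\<ge>N. \<forall>k\<ge>N. dist (?m n) (?m k) < e"
        unfolding dist_real_def using order_le_less_trans[OF measure_diff_le_D2w[OF \<mu> \<mu>]] by blast
    qed
    then obtain m where m: "?m \<longlonglongrightarrow> m" using Cauchy_convergent convergent_def by blast
    have tight: "\<exists>R. \<forall>n. measure (\<mu> n) (- cball 0 R) < e" if e: "e > 0" for e :: real
    proof -
      \<comment> \<open>The mass missed by a cutoff dominates the tail and, unlike the tail itself,
        varies with the measure by at most \<open>2 * ?C\<close> times the distance, uniformly in
        the radius.\<close>
      define g where "g n k = ?m n - (\<integral>x. cutoff (real (Suc k)) x \<partial>\<mu> n)" for n k
      obtain N where N: "\<And>n. n \<ge> N \<Longrightarrow> ?C * D2w (\<mu> n) (\<mu> N) < e / 4"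
        using small[of "e / 4"] e by force
      have "\<forall>\<^sub>F k in sequentially. g n k < e / 2" for n
      proof -
        have "g n \<longlonglongrightarrow> ?m n - ?m n"
          unfolding g_def by (intro tendsto_intros cutoff_integral_tendsto \<mu>)
        thus ?thesis using e by (intro order_tendstoD(2)) auto
      qed
      \<comment> \<open>One radius serves the finitely many measures up to \<open>N\<close>; all
        later ones are compared with the measure of index \<open>N\<close>.\<close>
      hence "\<forall>\<^sub>F k in sequentially. \<forall>n\<in>{..N}. g n k < e / 2"
        by (intro eventually_ball_finite) auto
      then obtain k where k: "\<And>n. n \<le> N \<Longrightarrow> g n k < e / 2"
        by (auto simp: eventually_sequentially)
      have "g n k < e" for n
      proof (cases "n \<le> N")
        case False
        have "g n k \<le> g N k + ?C * D2w (\<mu> n) (\<mu> N) + ?C * D2w (\<mu> n) (\<mu> N)"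
          using measure_diff_le_D2w[OF \<mu> \<mu>, of n N] cutoff_integral_diff_le[OF \<mu> \<mu>, of "real (Suc k)" n N]
          by (simp add: g_def)
        thus ?thesis using k[of N] N[of n] False by simp
      qed (use k[of n] e in simp)
      hence "measure (\<mu> n) (- cball 0 (real (Suc k))) < e" for n
        using measure_tail_le_cutoff[OF \<mu>, of "real (Suc k)" n] by (simp add: g_def order_le_less_trans)
      thus ?thesis by blast
    qed
    obtain r \<nu> where r: "strict_mono (r :: nat \<Rightarrow> nat)" and \<nu>: "\<nu> \<in> Mplus" "narrow_conv (\<mu> \<circ> r) \<nu> sequentially"
      using tight_Mplus_imp_narrow_convergent_subseq[OF \<mu> m tight] by blast
    have "limitin mtopology (\<mu> \<circ> r) \<nu> sequentially"
      using limitin_D2w_iff_narrow_conv[of "\<mu> \<circ> r" \<nu>] \<mu> \<nu> by simp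
    thus "\<exists>\<nu>. limitin mtopology \<mu> \<nu> sequentially"
      using MCauchy_convergent_subsequence[OF cau r] by blast
  qed
qed

text \<open>The constant 1 is a bounded continuous function, so narrow limits keep the total mass
  and \<open>Prob\<close> is closed in the complete space \<open>Mplus\<close>.\<close>

theorem mcomplete_Prob: "Metric_space.mcomplete (Prob :: (real^'d) measure set) D2w"
proof -
  interpret M: Metric_space "Mplus :: (real^'d) measure set" D2w by (rule Metric_space_Mplus)
  interpret P: Metric_space "Prob :: (real^'d) measure set" D2w by (rule Metric_space_Prob)
  show ?thesis
    unfolding P.mcomplete_def
  proof (intro allI impI)
    fix \<mu> :: "nat \<Rightarrow> (real^'d) measure" assume cau: "P.MCauchy \<mu>"
    hence \<mu>: "\<mu> n \<in> Prob" for n by (auto simp: P.MCauchy_def)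
    hence \<mu>M: "\<mu> n \<in> Mplus" for n using Prob_subset_Mplus by blast
    have "M.MCauchy \<mu>"
      using cau Prob_subset_Mplus unfolding M.MCauchy_def P.MCauchy_def by blast
    then obtain \<nu> where lim: "limitin M.mtopology \<mu> \<nu> sequentially"
      using mcomplete_Mplus M.mcomplete_def by blast
    hence \<nu>: "\<nu> \<in> Mplus" by (simp add: M.limitin_metric)
    have "narrow_conv \<mu> \<nu> sequentially"
      using lim limitin_D2w_iff_narrow_conv[of \<mu> \<nu>] \<mu>M \<nu> by simp
    hence "(\<lambda>n. \<integral>x. 1 \<partial>\<mu> n) \<longlonglongrightarrow> (\<integral>x. 1 \<partial>\<nu> :: real)"
      unfolding narrow_conv_def by (elim allE[of _ "\<lambda>_. 1"]) auto
    moreover have "(\<integral>x. 1 \<partial>\<mu> n) = (1 :: real)" for n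
      using \<mu>[of n] by (simp add: Prob_def prob_space.prob_space)
    ultimately have "measure \<nu> (space \<nu>) = 1"
      using LIMSEQ_unique[OF tendsto_const[of "1::real"]] by simp
    hence "prob_space \<nu>" using MplusD(1)[OF \<nu>]
      by (intro prob_spaceI) (simp add: finite_measure.emeasure_eq_measure)
    hence "\<nu> \<in> Prob" using \<nu> by (simp add: Prob_def)
    thus "\<exists>\<nu>. limitin P.mtopology \<mu> \<nu> sequentially"
      using lim \<mu> \<mu>M by (intro exI[of _ \<nu>]) (simp add: M.limitin_metric P.limitin_metric)
  qed
qed

theorem proposition3p3:
  shows
    "Metric_space (Mplus :: (real^'d) measure set) D2w
     \<and>
     (Metric_space.mcomplete (Mplus :: (real^'d) measure set) D2w
      \<and> (\<forall>(F :: 'i filter) (\<mu>s :: 'i \<Rightarrow> (real^'d) measure) \<mu>.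
           (\<forall>i. \<mu>s i \<in> Mplus) \<and> \<mu> \<in> Mplus \<longrightarrow>
           (limitin (Metric_space.mtopology Mplus D2w) \<mu>s \<mu> F \<longleftrightarrow> narrow_conv \<mu>s \<mu> F))
      \<and> Metric_space (Prob :: (real^'d) measure set) D2w
      \<and> Metric_space.mcomplete (Prob :: (real^'d) measure set) D2w
      \<and> separable_space (Metric_space.mtopology (Prob :: (real^'d) measure set) D2w))
     \<and>
     (\<exists>S :: (real^'d \<Rightarrow> real) set.
        countable S \<and> S \<subseteq> C2c \<and> S \<subseteq> ball_w \<and> closure_w S = ball_w \<and>
        (\<forall>\<mu>\<in>Mplus. \<forall>\<nu>\<in>Mplus.
           D2w \<mu> \<nu> = (SUP \<phi>\<in>S. \<bar>(\<integral>x. \<phi> x \<partial>\<mu>) - (\<integral>x. \<phi> x \<partial>\<nu>)\<bar>)))"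
proof (intro conjI allI impI)
  show "limitin (Metric_space.mtopology Mplus D2w) \<mu>s \<mu> F \<longleftrightarrow> narrow_conv \<mu>s \<mu> F"
    if "(\<forall>i. \<mu>s i \<in> Mplus) \<and> \<mu> \<in> Mplus"
    for F :: "'i filter" and \<mu>s :: "'i \<Rightarrow> (real^'d) measure" and \<mu>
    using that limitin_D2w_iff_narrow_conv[of \<mu>s \<mu> F] by simp
  obtain S :: "(real^'d \<Rightarrow> real) set" where "countable S" "S \<subseteq> C2c" "S \<subseteq> ball_w" "closure_w S = ball_w"
    "\<And>\<mu> \<nu>. \<mu> \<in> Mplus \<Longrightarrow> \<nu> \<in> Mplus \<Longrightarrow>
      D2w \<mu> \<nu> = (SUP \<phi>\<in>S. \<bar>(\<integral>x. \<phi> x \<partial>\<mu>) - (\<integral>x. \<phi> x \<partial>\<nu>)\<bar>)"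
    by (rule countable_dense_C2c) (rule that)
  thus "\<exists>S :: (real^'d \<Rightarrow> real) set.
        countable S \<and> S \<subseteq> C2c \<and> S \<subseteq> ball_w \<and> closure_w S = ball_w \<and>
        (\<forall>\<mu>\<in>Mplus. \<forall>\<nu>\<in>Mplus.
           D2w \<mu> \<nu> = (SUP \<phi>\<in>S. \<bar>(\<integral>x. \<phi> x \<partial>\<mu>) - (\<integral>x. \<phi> x \<partial>\<nu>)\<bar>))"
    by (intro exI[of _ S] conjI ballI)
qed (fact Metric_space_Mplus mcomplete_Mplus Metric_space_Prob mcomplete_Prob separable_space_Prob)+

end
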